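(* Let $\Phi:G_\infty\to\mathrm{Aut}_*(H)$ be as defined in the context. Then $\Phi$ is a bijection; equip $G_\infty$ with the group structure transported along $\Phi$. For $(\alpha,r)\in(k^\times)^{\mathbb{Z}}\rtimes\mathbb{Z}$ and $(\beta^{(i)})_{i\geq1}\in G_\infty$ put $(\alpha,r)\cdot(\beta^{(i)})_{i\ge1}=\big((\alpha^{-1})\langle i\rangle\,\beta^{(i)}[-r]\big)_{i\geq1}$. This is an action of $(k^\times)^{\mathbb{Z}}\rtimes\mathbb{Z}$ on $G_\infty$ by group automorphisms, and the maps $$G_\infty\rtimes\big((k^\times)^{\mathbb{Z}}\rtimes\mathbb{Z}\big)\to\mathrm{Aut}_c(H),\ (g,(\alpha,r))\mapsto\Phi(g)\phi_\alpha\theta_r,\qquad G_\infty\rtimes(k^\times)^{\mathbb{Z}}\to\mathrm{Aut}_0(H),\ (g,\alpha)\mapsto\Phi(g)\phi_\alpha$$ are group isomorphisms (where $(k^\times)^{\mathbb{Z}}$ acts on $G_\infty$ via its embedding $\alpha\mapsto(\alpha,0)$).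
   Context: Let $k$ be a field and $0\neq q\in k$ not a root of unity. $H=k_q[x,x^{-1},y]$ is the $k$-algebra generated by $x,x^{-1},y$ with $xx^{-1}=x^{-1}x=1$, $yx=qxy$, a Hopf algebra with $\Delta(x)=x\otimes x$, $\Delta(y)=y\otimes x+1\otimes y$, $\varepsilon(x)=1$, $\varepsilon(y)=0$; $\{x^ny^m:n\in\mathbb{Z},m\in\mathbb{N}\}$ is a $k$-basis. $\mathrm{Aut}_c(H)$ is the group under composition of coalgebra automorphisms of $H$, $\mathrm{Aut}_0(H)=\{\phi\in\mathrm{Aut}_c(H):\phi(1)=1\}$, and $\mathrm{Aut}_*(H)$ is the set of $\phi\in\mathrm{Aut}_0(H)$ such that for each $n$ there is $\beta_n\in k$ with $\phi(x^ny)=x^ny+\beta_n(x^{n+1}-x^n)$. Sequences: $k^{\mathbb{Z}}$ and $(k^\times)^{\mathbb{Z}}$ with componentwise operations; for a sequence $\alpha$ and $r\in\mathbb{Z}$, $\alpha[r]_n=\alpha_{n+r}$; $\alpha^{-1}=(\alpha_n^{-1})_n$; $\alpha\langle1\rangle=\alpha$, $\alpha\langle i\rangle=\alpha\,\alpha[1]\cdots\alpha[i-1]$ (componentwise product). $\theta_r$ is the linear map $x^ny^m\mapsto x^{n+r}y^m$; for $\alpha\in(k^\times)^{\mathbb{Z}}$, $\phi_\alpha$ is the linear map with $\phi_\alpha(x^n)=x^n$, $\phi_\alpha(x^ny^m)=(\prod_{i=0}^{m-1}\alpha_{n+i})x^ny^m$ for $m\ge1$. $(k^\times)^{\mathbb{Z}}\rtimes\mathbb{Z}$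 is the set of pairs $(\alpha,r)$ with $(\alpha,r)(\beta,t)=(\alpha\,\beta[-r],r+t)$. For a group $K$ acting on a group $G$ by automorphisms, $G\rtimes K$ has multiplication $(g,\kappa)(g',\kappa')=(g(\kappa\cdot g'),\kappa\kappa')$. Notation: $(n)_q=1+\dots+q^{n-1}$, $(n)!_q=(n)_q\cdots(1)_q$, $\binom{m}{i}_q=\frac{(m)!_q}{(i)!_q(m-i)!_q}$, $(m,j)_q=\prod_{i=0}^{j-1}(m-i)_q$ ($(m,0)_q=1$), $\binom{m}{s}_{q,i}=\prod_{j=0}^{i-1}\binom{m-js}{s}_q$; for $\beta\in k^{\mathbb{Z}}$, $\beta_{n,0}=1$, $\beta_{n,j}=\prod_{i=0}^{j-1}\beta_{n+i}$, $\beta_{n,s;0}=1$, $\beta_{n,s;j}=\prod_{i=0}^{j-1}\beta_{n+is}$. For $\beta\in k^{\mathbb{Z}}$, $\phi^{(1)}_\beta$ is the linear map with $\phi^{(1)}_\beta(x^ny^m)=x^ny^m+\sum_{l=0}^{m-1}(m,m-l)_q(\beta_{n,m-l}x^{n+m-l}-\beta_{n,m-l-1}\beta_{n+m-1}x^{n+m-l-1})y^l$; for $s\ge2$, $\phi^{(s)}_\beta(x^ny^m)=x^ny^m$ for $m<s$ and $\phi^{(s)}_\beta(x^ny^m)=x^ny^m+\sum_{1\le i\le\lfloor m/s\rfloor}\binom{m}{s}_{q,i}(\beta_{n,s;i}x^{n+is}-\beta_{n,s;i-1}\beta_{n+m-s}x^{n+is-s})y^{m-is}$ for $m\ge s$.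 $G_\infty$ is the set of sequences $(\beta^{(1)},\beta^{(2)},\dots)$ with $\beta^{(i)}\in k^{\mathbb{Z}}$, and $\Phi(\beta^{(1)},\beta^{(2)},\dots)$ is the linear map $\phi$ with $\phi(x^n)=x^n$ and $\phi(x^ny^m)=\phi^{(1)}_{\beta^{(1)}}\circ\cdots\circ\phi^{(m)}_{\beta^{(m)}}(x^ny^m)$ for $m\ge1$. *)

theory Defs
  imports "HOL-Library.Poly_Mapping" "HOL-Algebra.Group"
begin

section \<open>The Hopf algebra H = k_q[x,x^-1,y] as a vector space with basis x^n y^m\<close>

text \<open>Vectors of H are finitely supported coefficient functions on the basis
  indices (n,m) standing for x^n y^m; vectors of H (x) H are finitely supported
  functions on pairs of basis indices.  A linear map H \<rightarrow> H is represented by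
  its values on the basis (any such function extends uniquely to a linear map).\<close>

type_synonym 'k vecH = "(int \<times> nat) \<Rightarrow>\<^sub>0 'k"
type_synonym 'k vecHH = "((int \<times> nat) \<times> (int \<times> nat)) \<Rightarrow>\<^sub>0 'k"
type_synonym 'k linH = "(int \<times> nat) \<Rightarrow> 'k vecH"

definition smulv :: "'k::field \<Rightarrow> ('a \<Rightarrow>\<^sub>0 'k) \<Rightarrow> ('a \<Rightarrow>\<^sub>0 'k)" where
  "smulv c v = Poly_Mapping.map ((*) c) v"

definition lext :: "('a \<Rightarrow> ('b \<Rightarrow>\<^sub>0 'k::field)) \<Rightarrow> ('a \<Rightarrow>\<^sub>0 'k) \<Rightarrow> ('b \<Rightarrow>\<^sub>0 'k)" where
  "lext f v = (\<Sum>a\<in>Poly_Mapping.keys v. smulv (Poly_Mapping.lookup v a) (f a))"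

definition mon :: "int \<Rightarrow> nat \<Rightarrow> 'k::field vecH" where
  "mon n m = Poly_Mapping.single (n, m) 1"

definition compH :: "'k::field linH \<Rightarrow> 'k linH \<Rightarrow> 'k linH" where
  "compH f g = (\<lambda>b. lext f (g b))"

definition idH :: "'k::field linH" where
  "idH = (\<lambda>(n, m). mon n m)"

definition tensv :: "('a \<Rightarrow>\<^sub>0 'k::field) \<Rightarrow> ('b \<Rightarrow>\<^sub>0 'k) \<Rightarrow> (('a \<times> 'b) \<Rightarrow>\<^sub>0 'k)" where
  "tensv u w = (\<Sum>c\<in>Poly_Mapping.keys u. \<Sum>d\<in>Poly_Mapping.keys w. Poly_Mapping.single (c, d) (Poly_Mapping.lookup u c * Poly_Mapping.lookup w d))"

definition tensH :: "'k::field linH \<Rightarrow> 'k linH \<Rightarrow> ((int \<times> nat) \<times> (int \<times> nat)) \<Rightarrow> 'k vecHH" where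
  "tensH f g = (\<lambda>(c, d). tensv (f c) (g d))"

text \<open>multiplication: x^a y^b * x^c y^d = q^(b c) x^(a+c) y^(b+d), from y x = q x y\<close>
definition mulH :: "'k::field \<Rightarrow> 'k vecH \<Rightarrow> 'k vecH \<Rightarrow> 'k vecH" where
  "mulH q u v = (\<Sum>a\<in>Poly_Mapping.keys u. \<Sum>b\<in>Poly_Mapping.keys v.
     Poly_Mapping.single (fst a + fst b, snd a + snd b)
       (Poly_Mapping.lookup u a * Poly_Mapping.lookup v b * q powi (int (snd a) * fst b)))"

definition mulHH :: "'k::field \<Rightarrow> 'k vecHH \<Rightarrow> 'k vecHH \<Rightarrow> 'k vecHH" where
  "mulHH q u v = (\<Sum>a\<in>Poly_Mapping.keys u. \<Sum>b\<in>Poly_Mapping.keys v.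
     smulv (Poly_Mapping.lookup u a * Poly_Mapping.lookup v b)
       (tensv (mulH q (Poly_Mapping.single (fst a) 1) (Poly_Mapping.single (fst b) 1))
              (mulH q (Poly_Mapping.single (snd a) 1) (Poly_Mapping.single (snd b) 1))))"

text \<open>comultiplication, as the algebra map with Delta(x)=x (x) x, Delta(y) = y (x) x + 1 (x) y:
  Delta(x^n y^m) = (x^n (x) x^n) (y (x) x + 1 (x) y)^m\<close>
definition DeltaY :: "'k::field vecHH" where
  "DeltaY = Poly_Mapping.single ((0, 1), (1, 0)) 1 + Poly_Mapping.single ((0, 0), (0, 1)) 1"

definition Delta :: "'k::field \<Rightarrow> (int \<times> nat) \<Rightarrow> 'k vecHH" where
  "Delta q = (\<lambda>(n, m). mulHH q (Poly_Mapping.single ((n, 0), (n, 0)) 1)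
                         (((\<lambda>z. mulHH q z DeltaY) ^^ m) (Poly_Mapping.single ((0, 0), (0, 0)) 1)))"

definition epsH :: "'k::field vecH \<Rightarrow> 'k" where
  "epsH v = (\<Sum>a\<in>Poly_Mapping.keys v. Poly_Mapping.lookup v a * (if snd a = 0 then 1 else 0))"

definition Aut_c :: "'k::field \<Rightarrow> 'k linH set" where
  "Aut_c q = {\<phi>. bij (lext \<phi>)
      \<and> (\<forall>b. lext (Delta q) (\<phi> b) = lext (tensH \<phi> \<phi>) (Delta q b))
      \<and> (\<forall>b. epsH (\<phi> b) = epsH (mon (fst b) (snd b)))}"

definition Aut_0 :: "'k::field \<Rightarrow> 'k linH set" where
  "Aut_0 q = {\<phi> \<in> Aut_c q. \<phi> (0, 0) = mon 0 0}"

definition Aut_star :: "'k::field \<Rightarrow> 'k linH set" where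
  "Aut_star q = {\<phi> \<in> Aut_0 q. \<forall>n. \<exists>\<beta>. \<phi> (n, 1) = mon n 1 + smulv \<beta> (mon (n + 1) 0 - mon n 0)}"

definition AutcG :: "'k::field \<Rightarrow> 'k linH monoid" where
  "AutcG q = \<lparr>carrier = Aut_c q, mult = compH, one = idH\<rparr>"

definition Aut0G :: "'k::field \<Rightarrow> 'k linH monoid" where
  "Aut0G q = \<lparr>carrier = Aut_0 q, mult = compH, one = idH\<rparr>"

definition thetaH :: "int \<Rightarrow> 'k::field linH" where
  "thetaH r = (\<lambda>(n, m). mon (n + r) m)"

definition phi_alpha :: "(int \<Rightarrow> 'k::field) \<Rightarrow> 'k linH" where
  "phi_alpha \<alpha> = (\<lambda>(n, m). smulv (\<Prod>i<m. \<alpha> (n + int i)) (mon n m))"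

definition qnum :: "'k::field \<Rightarrow> nat \<Rightarrow> 'k" where
  "qnum q n = (\<Sum>i<n. q ^ i)"

definition qfact :: "'k::field \<Rightarrow> nat \<Rightarrow> 'k" where
  "qfact q n = (\<Prod>i\<in>{1..n}. qnum q i)"

definition qbinom :: "'k::field \<Rightarrow> nat \<Rightarrow> nat \<Rightarrow> 'k" where
  "qbinom q m i = qfact q m / (qfact q i * qfact q (m - i))"

definition qfall :: "'k::field \<Rightarrow> nat \<Rightarrow> nat \<Rightarrow> 'k" where
  "qfall q m j = (\<Prod>i<j. qnum q (m - i))"

definition qbinom_it :: "'k::field \<Rightarrow> nat \<Rightarrow> nat \<Rightarrow> nat \<Rightarrow> 'k" where
  "qbinom_it q m s i = (\<Prod>j<i. qbinom q (m - j * s) s)"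

definition bprod :: "(int \<Rightarrow> 'k::field) \<Rightarrow> int \<Rightarrow> nat \<Rightarrow> 'k" where
  "bprod \<beta> n j = (\<Prod>i<j. \<beta> (n + int i))"

definition bprod_s :: "(int \<Rightarrow> 'k::field) \<Rightarrow> int \<Rightarrow> nat \<Rightarrow> nat \<Rightarrow> 'k" where
  "bprod_s \<beta> n s j = (\<Prod>i<j. \<beta> (n + int (i * s)))"

definition phi1 :: "'k::field \<Rightarrow> (int \<Rightarrow> 'k) \<Rightarrow> 'k linH" where
  "phi1 q \<beta> = (\<lambda>(n, m). mon n m +
     (\<Sum>l<m. smulv (qfall q m (m - l))
        (smulv (bprod \<beta> n (m - l)) (mon (n + int (m - l)) l)
         - smulv (bprod \<beta> n (m - l - 1) * \<beta> (n + int m - 1)) (mon (n + int m - int l - 1) l))))"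

definition phis :: "'k::field \<Rightarrow> nat \<Rightarrow> (int \<Rightarrow> 'k) \<Rightarrow> 'k linH" where
  "phis q s \<beta> = (if s = 1 then phi1 q \<beta> else (\<lambda>(n, m).
     if m < s then mon n m else mon n m +
       (\<Sum>i\<in>{1..m div s}. smulv (qbinom_it q m s i)
          (smulv (bprod_s \<beta> n s i) (mon (n + int (i * s)) (m - i * s))
           - smulv (bprod_s \<beta> n s (i - 1) * \<beta> (n + int m - int s))
                   (mon (n + int (i * s) - int s) (m - i * s))))))"

text \<open>G_infinity: sequences (beta^(1), beta^(2), ...); we store beta^(i) as B (i - 1),
  so that an element of G_infinity is a function B :: nat \<Rightarrow> int \<Rightarrow> 'k.\<close>
type_synonym 'k Ginf = "nat \<Rightarrow> int \<Rightarrow> 'k"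

definition PhiG :: "'k::field \<Rightarrow> 'k Ginf \<Rightarrow> 'k linH" where
  "PhiG q B = (\<lambda>(n, m). if m = 0 then mon n 0
      else foldr compH (map (\<lambda>i. phis q (Suc i) (B i)) [0..<m]) idH (n, m))"

definition GinfG :: "'k::field \<Rightarrow> 'k Ginf monoid" where
  "GinfG q = \<lparr>carrier = UNIV,
     mult = (\<lambda>g h. the_inv_into UNIV (PhiG q) (compH (PhiG q g) (PhiG q h))),
     one = the_inv_into UNIV (PhiG q) idH\<rparr>"

definition UnitsSeq :: "(int \<Rightarrow> 'k::field) monoid" where
  "UnitsSeq = \<lparr>carrier = {\<alpha>. \<forall>n. \<alpha> n \<noteq> 0}, mult = (\<lambda>\<alpha> \<beta> n. \<alpha> n * \<beta> n), one = (\<lambda>_. 1)\<rparr>"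

definition UnitsZ :: "((int \<Rightarrow> 'k::field) \<times> int) monoid" where
  "UnitsZ = \<lparr>carrier = {(\<alpha>, r). \<forall>n. \<alpha> n \<noteq> 0},
     mult = (\<lambda>(\<alpha>, r) (\<beta>, t). (\<lambda>n. \<alpha> n * \<beta> (n - r), r + t)),
     one = (\<lambda>_. 1, 0)\<rparr>"

text \<open>(alpha,r) . (beta^(i))_i = ((alpha^-1)<i> beta^(i)[-r])_i; with beta^(i) = B (i-1)
  the factor (alpha^-1)<i> at n is prod_{j<i} alpha_(n+j)^-1.\<close>
definition actG :: "((int \<Rightarrow> 'k::field) \<times> int) \<Rightarrow> 'k Ginf \<Rightarrow> 'k Ginf" where
  "actG = (\<lambda>(\<alpha>, r) B. (\<lambda>i n. (\<Prod>j<Suc i. inverse (\<alpha> (n + int j))) * B i (n - r)))"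

definition sdprod :: "('g, 'x) monoid_scheme \<Rightarrow> ('c, 'y) monoid_scheme \<Rightarrow> ('c \<Rightarrow> 'g \<Rightarrow> 'g)
    \<Rightarrow> ('g \<times> 'c) monoid" where
  "sdprod G K act = \<lparr>carrier = carrier G \<times> carrier K,
     mult = (\<lambda>(g, \<kappa>) (g', \<kappa>'). (g \<otimes>\<^bsub>G\<^esub> act \<kappa> g', \<kappa> \<otimes>\<^bsub>K\<^esub> \<kappa>')),
     one = (\<one>\<^bsub>G\<^esub>, \<one>\<^bsub>K\<^esub>)\<rparr>"

end

theory Submission
  imports Defs
begin

text \<open>A linear map is a coalgebra map iff its transpose is multiplicative for the
  \<open>q\<close>-binomial convolution of functions on the basis; after division by \<open>q\<close>-factorials this
  is the incidence algebra of the poset of integers.  In that algebra the transpose of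
  \<open>\<phi>\<^sup>(\<^sup>s\<^sup>)\<close> is \<open>f \<mapsto> (1 - N)\<^sup>-\<^sup>1 f (1 - N)\<close>, where \<open>N\<close> is concentrated in degree \<open>s\<close> with values
  \<open>\<beta>\<^sub>n\<close>, so \<open>\<phi>\<^sup>(\<^sup>s\<^sup>)\<close> is a coalgebra map, and unitriangularity in the degree of \<open>y\<close> makes it bijective.
  Conversely, an automorphism that is the identity in degrees below \<open>s\<close> differs from it on
  \<open>x\<^sup>ny\<^sup>s\<close> by a skew-primitive element; the only available ones are the multiples of
  \<open>x\<^sup>n\<^sup>+\<^sup>s - x\<^sup>n\<close>, unless \<open>s = 1\<close>, where the diagonal part \<open>\<phi>\<^sub>\<alpha>\<close> enters as well.  So the
  sequence \<open>\<beta>\<^sup>(\<^sup>1\<^sup>), \<beta>\<^sup>(\<^sup>2\<^sup>), \<dots>\<close> can be split off one degree at a time and is unique.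
  Automorphisms permute the group-likes \<open>x\<^sup>n\<close>, and the nontrivial skew-primitives between
  \<open>x\<^sup>n\<close> and \<open>x\<^sup>n\<^sup>+\<^sup>1\<close> force this permutation to be a shift.\<close>

section \<open>Linear maps and the pairing with functions on the basis\<close>

lemma lookup_smulv [simp]: "Poly_Mapping.lookup (smulv c v) a = c * Poly_Mapping.lookup v a"
  by (simp add: smulv_def Poly_Mapping.map.rep_eq when_def)

lemma smulv_one [simp]: "smulv 1 v = v"
  by (rule poly_mapping_eqI) simp

text \<open>Arbitrary functions on the basis form the full linear dual; this is the evaluation.
  Identities between vectors are proved by testing them against all functionals.\<close>

definition pairing :: "('a \<Rightarrow>\<^sub>0 'k::field) \<Rightarrow> ('a \<Rightarrow> 'k) \<Rightarrow> 'k" where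
  "pairing v f = (\<Sum>a\<in>Poly_Mapping.keys v. Poly_Mapping.lookup v a * f a)"

lemma pairing_superset:
  assumes "finite A" "Poly_Mapping.keys v \<subseteq> A"
  shows "pairing v f = (\<Sum>a\<in>A. Poly_Mapping.lookup v a * f a)"
  unfolding pairing_def using assms
  by (intro sum.mono_neutral_left) (auto simp: in_keys_iff)

lemma pairing_zero [simp]: "pairing 0 f = 0"
  by (simp add: pairing_def)

lemma pairing_single [simp]: "pairing (Poly_Mapping.single a c) f = c * f a"
  by (cases "c = 0") (simp_all add: pairing_def)

lemma pairing_mon [simp]: "pairing (mon n m) f = f (n, m)"
  by (simp add: mon_def)

lemma pairing_add [simp]: "pairing (u + v) f = pairing u f + pairing v f"
proof -
  let ?A = "Poly_Mapping.keys u \<union> Poly_Mapping.keys v"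
  have "pairing (u + v) f = (\<Sum>a\<in>?A. Poly_Mapping.lookup (u + v) a * f a)"
    by (rule pairing_superset) (auto simp: Poly_Mapping.keys_add)
  moreover have "pairing u f = (\<Sum>a\<in>?A. Poly_Mapping.lookup u a * f a)"
    by (rule pairing_superset) auto
  moreover have "pairing v f = (\<Sum>a\<in>?A. Poly_Mapping.lookup v a * f a)"
    by (rule pairing_superset) auto
  ultimately show ?thesis
    by (simp add: lookup_add distrib_right sum.distrib)
qed

lemma pairing_smulv [simp]: "pairing (smulv c v) f = c * pairing v f"
proof -
  have "pairing (smulv c v) f = (\<Sum>a\<in>Poly_Mapping.keys v. Poly_Mapping.lookup (smulv c v) a * f a)"
    by (rule pairing_superset) (auto simp: in_keys_iff)
  then show ?thesis by (simp add: pairing_def sum_distrib_left mult.assoc)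
qed

lemma pairing_diff [simp]: "pairing (u - v) f = pairing u f - pairing v f"
proof -
  have "pairing (u - v + v) f = pairing (u - v) f + pairing v f" by (rule pairing_add)
  then show ?thesis by simp
qed

lemma pairing_sum [simp]: "pairing (\<Sum>i\<in>I. g i) f = (\<Sum>i\<in>I. pairing (g i) f)"
  by (induction I rule: infinite_finite_induct) simp_all

lemma pairing_if_eq [simp]: "pairing v (\<lambda>a. if a = c then 1 else 0) = Poly_Mapping.lookup v c"
proof -
  have "pairing v (\<lambda>a. if a = c then 1 else 0) =
      (\<Sum>a\<in>insert c (Poly_Mapping.keys v). Poly_Mapping.lookup v a * (if a = c then 1 else 0))"
    by (rule pairing_superset) auto
  also have "\<dots> = Poly_Mapping.lookup v c"
    by (simp add: if_distrib cong: if_cong)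
  finally show ?thesis .
qed

lemma pairing_eqI: "(\<And>f. pairing u f = pairing v f) \<Longrightarrow> u = v"
  by (rule poly_mapping_eqI) (metis pairing_if_eq)

lemma pairing_cong_keys:
  "(\<And>a. a \<in> Poly_Mapping.keys v \<Longrightarrow> f a = g a) \<Longrightarrow> pairing v f = pairing v g"
  by (simp add: pairing_def)

text \<open>The transpose of a linear map. It determines the map and reverses composition.\<close>

definition pull :: "('a \<Rightarrow> ('b \<Rightarrow>\<^sub>0 'k::field)) \<Rightarrow> ('b \<Rightarrow> 'k) \<Rightarrow> 'a \<Rightarrow> 'k" where
  "pull \<phi> f = (\<lambda>b. pairing (\<phi> b) f)"

lemma pairing_lext [simp]: "pairing (lext \<phi> v) f = pairing v (pull \<phi> f)"
  by (simp add: lext_def pull_def) (simp add: pairing_def)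

lemma pull_inject: "pull \<phi> = pull \<psi> \<Longrightarrow> \<phi> = \<psi>"
  unfolding pull_def by (metis (no_types, lifting) ext pairing_eqI)

lemma pull_compH [simp]: "pull (compH \<phi> \<psi>) f = pull \<psi> (pull \<phi> f)"
  by (simp add: pull_def compH_def)

lemma pull_idH [simp]: "pull idH f = f"
  by (auto simp: pull_def idH_def)

lemma pairing_tensv:
  "pairing (tensv u w) (\<lambda>(c, d). f c * g d) = pairing u f * pairing w g"
  by (simp add: tensv_def sum_product) (simp add: pairing_def sum_product mult_ac)

text \<open>The indicator of a pair is a product of two indicators, so product functionals already
  separate the vectors of a tensor product.\<close>

lemma tensor_eqI:
  fixes u v :: "('a \<times> 'b) \<Rightarrow>\<^sub>0 'k::field"
  assumes "\<And>f g. pairing u (\<lambda>(c, d). f c * g d) = pairing v (\<lambda>(c, d). f c * g d)"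
  shows "u = v"
proof (rule poly_mapping_eqI)
  fix a :: "'a \<times> 'b"
  have "(\<lambda>(c, d). (if c = fst a then 1 else 0) * (if d = snd a then 1 else 0)) =
     (\<lambda>b. if b = a then 1 else (0::'k))" by (cases a) (auto simp: fun_eq_iff)
  with assms[of "\<lambda>c. if c = fst a then 1 else 0" "\<lambda>d. if d = snd a then 1 else 0"]
  show "Poly_Mapping.lookup u a = Poly_Mapping.lookup v a" by (simp only: pairing_if_eq)
qed

lemma lookup_lext: "Poly_Mapping.lookup (lext \<phi> v) c = pairing v (\<lambda>b. Poly_Mapping.lookup (\<phi> b) c)"
  using pairing_lext[of \<phi> v "\<lambda>a. if a = c then 1 else 0"] by (simp add: pull_def)

lemma lext_mon [simp]: "lext \<phi> (mon n m) = \<phi> (n, m)"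
  by (rule pairing_eqI) (simp add: pull_def)

lemma lext_add: "lext \<phi> (u + v) = lext \<phi> u + lext \<phi> v"
  by (rule pairing_eqI) simp

lemma lext_diff: "lext \<phi> (u - v) = lext \<phi> u - lext \<phi> v"
  by (rule pairing_eqI) simp

lemma lext_smulv: "lext \<phi> (smulv c v) = smulv c (lext \<phi> v)"
  by (rule pairing_eqI) simp

lemma lext_zero: "lext \<phi> 0 = 0"
  by (rule pairing_eqI) simp

lemma lext_compH: "lext (compH \<phi> \<psi>) v = lext \<phi> (lext \<psi> v)"
  by (rule pairing_eqI) simp

lemma lext_idH [simp]: "lext idH v = v"
  by (rule pairing_eqI) simp

lemma compH_assoc: "compH (compH f g) h = compH f (compH g h)"
  by (rule pull_inject) (rule ext, simp)

lemma compH_idH [simp]: "compH \<phi> idH = \<phi>" "compH idH \<phi> = \<phi>"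
  by (rule pull_inject, rule ext, simp)+

lemma lext_inject:
  fixes \<phi> \<psi> :: "'k::field linH"
  assumes "lext \<phi> = lext \<psi>"
  shows "\<phi> = \<psi>"
proof
  fix b
  show "\<phi> b = \<psi> b"
    using assms lext_mon[of \<phi> "fst b" "snd b"] lext_mon[of \<psi> "fst b" "snd b"] by simp
qed

lemma keys_mon [simp]: "Poly_Mapping.keys (mon n m :: 'k::field vecH) = {(n, m)}"
  by (simp add: mon_def)

lemma lookup_mon: "Poly_Mapping.lookup (mon n m) c = (if c = (n, m) then 1 else 0)"
  by (auto simp: mon_def lookup_single when_def)

section \<open>Unitriangular maps\<close>

text \<open>Each basis vector is sent to itself plus terms of strictly smaller degree in y.\<close>

definition unitri :: "'k::field linH \<Rightarrow> bool" where
  "unitri \<phi> \<longleftrightarrow> (\<forall>b c. snd b \<le> snd c \<longrightarrow> Poly_Mapping.lookup (\<phi> b) c = (if b = c then 1 else 0))"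

text \<open>The correction terms have degree below that of \<open>c\<close>, so they cannot change
  the coefficient there.\<close>

lemma unitri_lookup_lext:
  assumes "unitri \<phi>" "\<And>b. b \<in> Poly_Mapping.keys v \<Longrightarrow> snd b \<le> snd c"
  shows "Poly_Mapping.lookup (lext \<phi> v) c = Poly_Mapping.lookup v c"
proof -
  have "Poly_Mapping.lookup (lext \<phi> v) c = pairing v (\<lambda>b. if b = c then 1 else 0)"
    unfolding lookup_lext using assms by (intro pairing_cong_keys) (simp add: unitri_def del: split_paired_All)
  then show ?thesis by simp
qed

lemma unitri_idH: "unitri idH"
  by (auto simp: unitri_def idH_def lookup_mon)

lemma unitri_keys: "unitri \<phi> \<Longrightarrow> d \<in> Poly_Mapping.keys (\<phi> b) \<Longrightarrow> snd d \<le> snd b"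
  unfolding unitri_def in_keys_iff by (metis linorder_linear)

lemma unitri_compH:
  assumes "unitri \<phi>" "unitri \<psi>"
  shows "unitri (compH \<phi> \<psi>)"
  unfolding unitri_def
proof (intro allI impI)
  fix b c :: "int \<times> nat"
  assume le: "snd b \<le> snd c"
  have "Poly_Mapping.lookup (lext \<phi> (\<psi> b)) c = Poly_Mapping.lookup (\<psi> b) c"
    using unitri_lookup_lext[OF assms(1)] unitri_keys[OF assms(2)] le order_trans by blast
  then show "Poly_Mapping.lookup (compH \<phi> \<psi> b) c = (if b = c then 1 else 0)"
    using assms(2) le by (simp add: compH_def unitri_def del: split_paired_All)
qed

text \<open>Coefficients in the top degree survive, which gives injectivity. Surjectivity is an
  induction on a bound for the degree.\<close>

lemma unitri_bij:
  fixes \<phi> :: "'k::field linH"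
  assumes "unitri \<phi>"
  shows "bij (lext \<phi>)"
proof (rule bijI)
  have zero: "v = 0" if "lext \<phi> v = 0" for v
  proof (rule ccontr)
    assume "v \<noteq> 0"
    then have "Max (snd ` Poly_Mapping.keys v) \<in> snd ` Poly_Mapping.keys v" by (intro Max_in) auto
    then obtain c where c: "c \<in> Poly_Mapping.keys v" and Max: "Max (snd ` Poly_Mapping.keys v) = snd c"
      by (rule imageE)
    have le: "snd b \<le> snd c" if "b \<in> Poly_Mapping.keys v" for b
      unfolding Max[symmetric] using that by (intro Max_ge) auto
    have "Poly_Mapping.lookup v c = 0"
      using unitri_lookup_lext[of \<phi> v c] assms le that by simp
    then show False using c by (simp add: in_keys_iff)
  qed
  show "inj (lext \<phi>)"
  proof (rule injI)
    fix v w assume "lext \<phi> v = lext \<phi> w"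
    then have "lext \<phi> (v - w) = 0" by (simp add: lext_diff)
    then show "v = w" using zero by fastforce
  qed
  have "\<exists>w. lext \<phi> w = v" if "\<And>c. c \<in> Poly_Mapping.keys v \<Longrightarrow> snd c < m" for m v
    using that
  proof (induction m arbitrary: v)
    case 0
    then have "Poly_Mapping.keys v = {}" by (intro equals0I) blast
    then have "lext \<phi> 0 = v" by (simp add: lext_zero)
    then show ?case ..
  next
    case (Suc m)
    \<comment> \<open>The vector \<open>v\<close> is its own first approximate preimage: the error
      has lost the top degree and falls under the induction hypothesis.\<close>
    have "\<exists>w. lext \<phi> w = v - lext \<phi> v" (is "\<exists>w. ?P w")
    proof (rule Suc.IH, rule ccontr)
      fix c assume c: "c \<in> Poly_Mapping.keys (v - lext \<phi> v)" "\<not> snd c < m"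
      have "Poly_Mapping.lookup (lext \<phi> v) c = Poly_Mapping.lookup v c"
        using Suc.prems c(2) by (intro unitri_lookup_lext[OF assms]) fastforce
      then show False using c(1) by (simp add: in_keys_iff lookup_minus)
    qed
    then obtain w where "?P w" ..
    then have "lext \<phi> (w + v) = v" by (simp add: lext_add)
    then show ?case ..
  qed
  moreover have "\<exists>m. \<forall>c\<in>Poly_Mapping.keys v. snd c < m" for v :: "'k vecH"
    using finite_nat_set_iff_bounded[of "snd ` Poly_Mapping.keys v"] by auto
  ultimately have "\<exists>w. lext \<phi> w = v" for v by blast
  then show "surj (lext \<phi>)" unfolding surj_def by (auto intro: sym)
qed

section \<open>Comultiplication as dual of a convolution\<close>

text \<open>The product dual to \<open>Delta\<close>. After division by \<open>qfact q m\<close>,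
  the value at (n, m) is that of an incidence function on the interval from n to n + m.\<close>

definition qconv :: "'k::field \<Rightarrow> (int \<times> nat \<Rightarrow> 'k) \<Rightarrow> (int \<times> nat \<Rightarrow> 'k) \<Rightarrow> int \<times> nat \<Rightarrow> 'k" where
  "qconv q f g = (\<lambda>(n, m). \<Sum>i\<le>m. qbinom q m i * f (n, i) * g (n + int i, m - i))"

definition counit :: "int \<times> nat \<Rightarrow> 'k::field" where
  "counit = (\<lambda>(n, m). if m = 0 then 1 else 0)"

lemma epsH_eq_pairing: "epsH v = pairing v counit"
  by (simp add: epsH_def pairing_def counit_def case_prod_unfold)

lemma mulH_single:
  "mulH q (Poly_Mapping.single a 1) (Poly_Mapping.single b 1) =
     Poly_Mapping.single (fst a + fst b, snd a + snd b) (q powi (int (snd a) * fst b))"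
  by (simp add: mulH_def)

lemma tensv_single:
  "tensv (Poly_Mapping.single a c) (Poly_Mapping.single b d) = Poly_Mapping.single (a, b) (c * d)"
  by (cases "c = 0"; cases "d = 0") (simp_all add: tensv_def)

lemma pairing_mulHH:
  "pairing (mulHH q u v) F = pairing u (\<lambda>a. pairing v (\<lambda>b.
     q powi (int (snd (fst a)) * fst (fst b)) * q powi (int (snd (snd a)) * fst (snd b)) *
     F ((fst (fst a) + fst (fst b), snd (fst a) + snd (fst b)),
        (fst (snd a) + fst (snd b), snd (snd a) + snd (snd b)))))"
  by (simp add: mulHH_def mulH_single tensv_single)
     (simp add: pairing_def sum_distrib_left mult_ac)

section \<open>q-integers, q-binomials and the comultiplication formula\<close>

lemma qfact_0 [simp]: "qfact q 0 = 1"
  by (simp add: qfact_def)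

lemma qfact_Suc [simp]: "qfact q (Suc n) = qnum q (Suc n) * qfact q n"
  by (simp add: qfact_def mult.commute)

lemma qnum_1 [simp]: "qnum q (Suc 0) = 1"
  by (simp add: qnum_def)

lemma qnum_add: "qnum q (m + n) = qnum q m + q ^ m * qnum q n"
  by (induction n) (simp_all add: qnum_def power_add algebra_simps)

locale generic_q =
  fixes q :: "'k::field"
  assumes q_not_root: "\<forall>n::nat. n > 0 \<longrightarrow> q ^ n \<noteq> 1"
begin

text \<open>From (q - 1) (n)_q = q^n - 1. All later divisions by q-factorials rest on this.\<close>

lemma qnum_nz: "n > 0 \<Longrightarrow> qnum q n \<noteq> 0"
  using q_not_root power_diff_1_eq[of q n] by (metis diff_eq_eq mult_zero_right add_0 qnum_def)

lemma qfact_nz [simp]: "qfact q n \<noteq> 0"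
  by (induction n) (simp_all add: qnum_nz)

lemma qbinom_0 [simp]: "qbinom q m 0 = 1" and qbinom_self [simp]: "qbinom q m m = 1"
  by (simp_all add: qbinom_def)

text \<open>The q-Pascal rule, from splitting (m+1)_q as (m-i)_q + q^(m-i) (i+1)_q.\<close>

lemma qbinom_Suc:
  assumes "i < m"
  shows "qbinom q (Suc m) (Suc i) = q ^ (m - i) * qbinom q m i + qbinom q m (Suc i)"
proof -
  obtain k where k: "m = Suc (i + k)" using assms less_iff_Suc_add by auto
  have 1: "qnum q (Suc (Suc (i + k))) = qnum q (Suc k) + q ^ Suc k * qnum q (Suc i)"
    using qnum_add[of q "Suc k" "Suc i"] by (simp add: algebra_simps)
  have "qfact q (Suc k) \<noteq> 0" "qfact q (Suc i) \<noteq> 0" by (simp_all only: qfact_nz) simp_all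
  then show ?thesis unfolding qbinom_def k
    by (simp add: 1 divide_simps del: power_Suc) (simp add: algebra_simps)
qed

text \<open>The q-binomial theorem for the m-th power of \<open>DeltaY\<close>. Multiplying on the
  right by one more factor moves y^(m-i) past x and produces q^(m-i), exactly the weight in the
  q-Pascal rule.\<close>

lemma pairing_DeltaY_power:
  "pairing (((\<lambda>z. mulHH q z DeltaY) ^^ m) (Poly_Mapping.single ((0, 0), (0, 0)) 1)) F =
    (\<Sum>i\<le>m. qbinom q m i * F ((0, i), (int i, m - i)))"
proof (induction m arbitrary: F)
  case 0
  then show ?case by simp
next
  case (Suc m)
  let ?G = "\<lambda>i. F ((0, i), (int i, Suc m - i))"
  have powi: "q powi (int m - int i) = q ^ (m - i)" if "i \<le> m" for i
    using that by (metis of_nat_diff power_int_of_nat)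
  have "pairing (((\<lambda>z. mulHH q z DeltaY) ^^ Suc m) (Poly_Mapping.single ((0, 0), (0, 0)) 1)) F
      = (\<Sum>i\<le>m. qbinom q m i * (q ^ (m - i) * ?G (Suc i) + ?G i))"
    unfolding funpow.simps comp_def pairing_mulHH Suc.IH
    by (auto intro!: sum.cong simp: DeltaY_def Suc_diff_le add.commute powi)
  also have "\<dots> = (\<Sum>i\<le>m. q ^ (m - i) * qbinom q m i * ?G (Suc i)) + (\<Sum>i\<le>m. qbinom q m i * ?G i)"
    by (simp add: distrib_left sum.distrib mult_ac)
  \<comment> \<open>The last term of one sum and the first term of the other are split off, so that
    the remaining terms pair up under the q-Pascal rule.\<close>
  also have "(\<Sum>i\<le>m. q ^ (m - i) * qbinom q m i * ?G (Suc i)) =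
      ?G (Suc m) + (\<Sum>i<m. q ^ (m - i) * qbinom q m i * ?G (Suc i))"
    by (simp add: lessThan_Suc_atMost[symmetric])
  also have "(\<Sum>i\<le>m. qbinom q m i * ?G i) = ?G 0 + (\<Sum>i<m. qbinom q m (Suc i) * ?G (Suc i))"
    by (simp only: lessThan_Suc_atMost[symmetric] sum.lessThan_Suc_shift) simp
  also have "?G (Suc m) + (\<Sum>i<m. q ^ (m - i) * qbinom q m i * ?G (Suc i)) +
      (?G 0 + (\<Sum>i<m. qbinom q m (Suc i) * ?G (Suc i))) =
      ?G 0 + (\<Sum>i<m. qbinom q (Suc m) (Suc i) * ?G (Suc i)) + ?G (Suc m)"
    by (simp add: qbinom_Suc distrib_right sum.distrib)
  also have "\<dots> = (\<Sum>i\<le>Suc m. qbinom q (Suc m) i * ?G i)"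
    unfolding lessThan_Suc_atMost[symmetric] sum.lessThan_Suc_shift[of _ "Suc m"] sum.lessThan_Suc[of _ m]
    by (simp add: add.assoc)
  finally show ?case .
qed

lemma pairing_Delta:
  "pairing (Delta q b) (\<lambda>(c, d). f c * g d) = qconv q f g b"
  by (cases b) (simp add: Delta_def pairing_mulHH pairing_DeltaY_power qconv_def mult.assoc)

text \<open>Both sides are tested against product functionals: one yields the transpose of a
  convolution, the other the convolution of transposes.\<close>

lemma comult_compat_iff:
  "lext (Delta q) (\<phi> b) = lext (tensH \<phi> \<phi>) (Delta q b) \<longleftrightarrow>
   (\<forall>f g. pull \<phi> (qconv q f g) b = qconv q (pull \<phi> f) (pull \<phi> g) b)"
proof -
  have L: "pairing (lext (Delta q) (\<phi> b)) (\<lambda>(c, d). f c * g d) = pull \<phi> (qconv q f g) b" for f g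
    by (simp add: pull_def[of "Delta q"] pairing_Delta) (simp add: pull_def)
  have "pull (tensH \<phi> \<phi>) (\<lambda>(c, d). f c * g d) = (\<lambda>(c, d). pull \<phi> f c * pull \<phi> g d)" for f g
    by (auto simp: pull_def tensH_def pairing_tensv)
  then have R: "pairing (lext (tensH \<phi> \<phi>) (Delta q b)) (\<lambda>(c, d). f c * g d) =
      qconv q (pull \<phi> f) (pull \<phi> g) b" for f g
    by (simp add: pairing_Delta)
  show ?thesis
  proof
    assume "lext (Delta q) (\<phi> b) = lext (tensH \<phi> \<phi>) (Delta q b)"
    then show "\<forall>f g. pull \<phi> (qconv q f g) b = qconv q (pull \<phi> f) (pull \<phi> g) b"
      by (simp only: L[symmetric] R[symmetric] simp_thms)
  qed (rule tensor_eqI, simp only: L R)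
qed

definition coalg :: "'k linH \<Rightarrow> bool" where
  "coalg \<phi> \<longleftrightarrow> (\<forall>f g. pull \<phi> (qconv q f g) = qconv q (pull \<phi> f) (pull \<phi> g)) \<and> pull \<phi> counit = counit"

lemma Aut_c_iff_coalg: "\<phi> \<in> Aut_c q \<longleftrightarrow> bij (lext \<phi>) \<and> coalg \<phi>"
  by (auto simp: coalg_def Aut_c_def comult_compat_iff epsH_eq_pairing pull_def fun_eq_iff)

lemma coalg_compH: "coalg \<phi> \<Longrightarrow> coalg \<psi> \<Longrightarrow> coalg (compH \<phi> \<psi>)"
  by (simp add: coalg_def)

lemma coalg_idH: "coalg idH"
  by (simp add: coalg_def)

section \<open>The convolution algebra and its inner automorphisms\<close>

lemma qconv_counit [simp]: "qconv q counit f = f" "qconv q f counit = f"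
proof -
  have 1: "(\<Sum>i\<le>m. qbinom q m i * counit (n, i) * f (n + int i, m - i)) = f (n, m)" for n m
    by (subst sum.mono_neutral_right[of _ "{0}"]) (auto simp: counit_def)
  have 2: "(\<Sum>i\<le>m. qbinom q m i * f (n, i) * counit (n + int i, m - i)) = f (n, m)" for n m
    by (subst sum.mono_neutral_right[of _ "{m}"]) (auto simp: counit_def)
  show "qconv q counit f = f" "qconv q f counit = f"
    by (auto simp: qconv_def 1 2)
qed

text \<open>Both sides run over the triples with sum \<open>k\<close>. In the induction step, the
  terms with positive last entry are the instance for the function with shifted last
  argument.\<close>

lemma sum_triple_reindex:
  "(\<Sum>j\<le>k. \<Sum>i\<le>j. f i (j - i) (k - j)) = (\<Sum>j\<le>k. \<Sum>i\<le>k - j. f j i (k - j - i))"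
  for f :: "nat \<Rightarrow> nat \<Rightarrow> nat \<Rightarrow> 'k"
proof (induction k arbitrary: f)
  case (Suc k)
  show ?case
    using Suc[of "\<lambda>i j l. f i j (Suc l)"]
    by (simp add: Suc_diff_le sum.distrib add.assoc)
qed simp

text \<open>Both bracketings produce the q-multinomial coefficient (m)! / ((i)! (j)! (l)!).\<close>

lemma qconv_assoc: "qconv q (qconv q f g) h = qconv q f (qconv q g h)"
proof -
  have "qconv q (qconv q f g) h (n, m) = qconv q f (qconv q g h) (n, m)" for n m
  proof -
    let ?t = "\<lambda>i j l. qfact q m / (qfact q i * qfact q j * qfact q l) * f (n, i) *
      g (n + int i, j) * h (n + int (i + j), l)"
    have "qconv q (qconv q f g) h (n, m) = (\<Sum>j\<le>m. \<Sum>i\<le>j. ?t i (j - i) (m - j))"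
      by (auto simp: qconv_def sum_distrib_left sum_distrib_right qbinom_def mult_ac intro!: sum.cong)
    also have "\<dots> = (\<Sum>j\<le>m. \<Sum>i\<le>m - j. ?t j i (m - j - i))"
      by (rule sum_triple_reindex)
    also have "\<dots> = qconv q f (qconv q g h) (n, m)"
      by (auto simp: qconv_def sum_distrib_left sum_distrib_right qbinom_def add.assoc mult_ac
          intro!: sum.cong)
    finally show ?thesis .
  qed
  then show ?thesis by auto
qed

text \<open>Conjugation by an invertible element respects products, because the inner factors
  \<open>v\<close> and \<open>u\<close> cancel.\<close>

lemma coalg_inner:
  assumes "\<And>f. pull \<phi> f = qconv q (qconv q u f) v" "qconv q u v = counit" "qconv q v u = counit"
  shows "coalg \<phi>"
proof -
  have "qconv q (qconv q (qconv q u f) v) (qconv q (qconv q u g) v) = qconv q (qconv q u (qconv q f g)) v"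
    for f g
    by (metis assms(3) qconv_assoc qconv_counit(1))
  then show ?thesis using assms by (simp add: coalg_def)
qed

section \<open>The maps \<open>\<phi>\<^sup>(\<^sup>s\<^sup>)\<close> as inner automorphisms\<close>

text \<open>The element 1 - N, with N of degree s.\<close>

definition step_elem :: "nat \<Rightarrow> (int \<Rightarrow> 'k) \<Rightarrow> int \<times> nat \<Rightarrow> 'k" where
  "step_elem s \<beta> = (\<lambda>(n, m). if m = 0 then 1 else if m = s then - \<beta> n else 0)"

text \<open>The geometric series of N. The power N^i lives in degree i s, so at most one power
  contributes at each index.\<close>

definition step_inv :: "nat \<Rightarrow> (int \<Rightarrow> 'k) \<Rightarrow> int \<times> nat \<Rightarrow> 'k" where
  "step_inv s \<beta> = (\<lambda>(n, m). if s dvd m then qbinom_it q m s (m div s) * bprod_s \<beta> n s (m div s) else 0)"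

lemma qbinom_it_Suc: "qbinom_it q m s (Suc i) = qbinom q m s * qbinom_it q (m - s) s i"
  by (simp add: qbinom_it_def prod.lessThan_Suc_shift del: prod.lessThan_Suc)

lemma qbinom_it_0 [simp]: "qbinom_it q m s 0 = 1"
  by (simp add: qbinom_it_def)

lemma bprod_s_0 [simp]: "bprod_s \<beta> n s 0 = 1"
  by (simp add: bprod_s_def)

lemma bprod_s_Suc: "bprod_s \<beta> n s (Suc i) = \<beta> n * bprod_s \<beta> (n + int s) s i"
  by (simp add: bprod_s_def prod.lessThan_Suc_shift algebra_simps del: prod.lessThan_Suc)

lemma bprod_s_Suc': "bprod_s \<beta> n s (Suc i) = bprod_s \<beta> n s i * \<beta> (n + int (i * s))"
  by (simp add: bprod_s_def)

lemma qconv_step_elem_left: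
  assumes "s > 0"
  shows "qconv q (step_elem s \<beta>) f (n, m) =
    f (n, m) - (if s \<le> m then qbinom q m s * \<beta> n * f (n + int s, m - s) else 0)"
proof -
  have "qconv q (step_elem s \<beta>) f (n, m) =
      (\<Sum>i\<le>m. (if i = 0 then f (n, m) else 0) + (if i = s then - (qbinom q m s * \<beta> n * f (n + int s, m - s)) else 0))"
    unfolding qconv_def using assms by (auto simp: step_elem_def intro!: sum.cong)
  then show ?thesis by (simp add: sum.distrib)
qed

lemma qbinom_sym: "i \<le> m \<Longrightarrow> qbinom q m (m - i) = qbinom q m i"
  by (simp add: qbinom_def mult.commute)

lemma qconv_step_elem_right:
  assumes "s > 0"
  shows "qconv q f (step_elem s \<beta>) (n, m) =
    f (n, m) - (if s \<le> m then qbinom q m s * \<beta> (n + int m - int s) * f (n, m - s) else 0)"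
proof -
  \<comment> \<open>The inner test \<open>s \<le> m\<close> is essential: for s > m the truncated
    difference \<open>m - s\<close> is 0, an index inside the range.\<close>
  have "qconv q f (step_elem s \<beta>) (n, m) =
      (\<Sum>i\<le>m. (if i = m then f (n, m) else 0) +
        (if i = m - s then (if s \<le> m then - (qbinom q m s * \<beta> (n + int m - int s) * f (n, m - s)) else 0) else 0))"
    unfolding qconv_def prod.case
    by (rule sum.cong) (use assms in \<open>auto simp: step_elem_def qbinom_sym algebra_simps\<close>)
  then show ?thesis by (simp add: sum.distrib)
qed

text \<open>For J = \<open>step_inv s \<beta>\<close> these say J = 1 + N J and J = 1 + J N. They
  peel off the first, respectively the last, factor of the product of the \<beta>.\<close>

lemma step_inv_eq:
  assumes "s > 0"
  shows "step_inv s \<beta> (n, m) = (if m = 0 then 1 else 0) +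
    (if s \<le> m then qbinom q m s * \<beta> n * step_inv s \<beta> (n + int s, m - s) else 0)"
    and "step_inv s \<beta> (n, m) = (if m = 0 then 1 else 0) +
    (if s \<le> m then qbinom q m s * \<beta> (n + int m - int s) * step_inv s \<beta> (n, m - s) else 0)"
proof -
  have *: "\<not> s \<le> m \<Longrightarrow> s dvd m \<Longrightarrow> m = 0" using dvd_imp_le by blast
  have d: "s \<le> m \<Longrightarrow> s dvd m - s \<longleftrightarrow> s dvd m" by (simp add: dvd_diff_nat dvd_minus_self)
  have m: "m div s = Suc ((m - s) div s)" if "s \<le> m" using assms that by (simp add: le_div_geq)
  have e: "int ((m - s) div s * s) = int m - int s" if "s \<le> m" "s dvd m"
    using that by (simp add: of_nat_diff dvd_diff_nat)
  show "step_inv s \<beta> (n, m) = (if m = 0 then 1 else 0) +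
    (if s \<le> m then qbinom q m s * \<beta> n * step_inv s \<beta> (n + int s, m - s) else 0)"
    using assms * by (auto simp: step_inv_def d m qbinom_it_Suc bprod_s_Suc)
  show "step_inv s \<beta> (n, m) = (if m = 0 then 1 else 0) +
    (if s \<le> m then qbinom q m s * \<beta> (n + int m - int s) * step_inv s \<beta> (n, m - s) else 0)"
    using assms * by (auto simp: step_inv_def d m qbinom_it_Suc bprod_s_Suc' e add_diff_eq)
qed

lemma step_inverse:
  assumes "s > 0"
  shows "qconv q (step_inv s \<beta>) (step_elem s \<beta>) = counit" "qconv q (step_elem s \<beta>) (step_inv s \<beta>) = counit"
proof -
  have "qconv q (step_inv s \<beta>) (step_elem s \<beta>) (n, m) = counit (n, m)" for n m
    using step_inv_eq(2)[OF assms, of \<beta> n m] by (simp add: qconv_step_elem_right assms counit_def)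
  moreover have "qconv q (step_elem s \<beta>) (step_inv s \<beta>) (n, m) = counit (n, m)" for n m
    using step_inv_eq(1)[OF assms, of \<beta> n m] by (simp add: qconv_step_elem_left assms counit_def)
  ultimately show "qconv q (step_inv s \<beta>) (step_elem s \<beta>) = counit" "qconv q (step_elem s \<beta>) (step_inv s \<beta>) = counit"
    by auto
qed

lemma qbinom_it_eq:
  "i * s \<le> m \<Longrightarrow> qbinom_it q m s i = qfact q m / (qfact q s ^ i * qfact q (m - i * s))"
proof (induction i arbitrary: m)
  case (Suc i)
  then have "i * s \<le> m - s" by simp
  from Suc.IH[OF this] show ?case by (simp add: qbinom_it_Suc qbinom_def)
qed simp

lemma qfall_eq: "i \<le> m \<Longrightarrow> qfall q m i = qfact q m / qfact q (m - i)"
proof (induction i)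
  case (Suc i)
  have "m - i = Suc (m - Suc i)" using Suc.prems by simp
  then have "qfact q (m - i) = qnum q (m - i) * qfact q (m - Suc i)" by simp
  moreover have "qfall q m (Suc i) = qfall q m i * qnum q (m - i)" by (simp add: qfall_def)
  moreover have "qnum q (m - i) \<noteq> 0" using Suc.prems by (intro qnum_nz) simp
  ultimately show ?case using Suc by simp
qed (simp add: qfall_def)

text \<open>Only degrees divisible by s contribute, and the q-binomials telescope:
  \<open>qbinom q m (i * s) * qbinom_it q (i * s) s i\<close> equals
  \<open>qbinom_it q m s i\<close>.\<close>

lemma qconv_step_inv_left:
  assumes "s > 0"
  shows "qconv q (step_inv s \<beta>) f (n, m) =
    (\<Sum>i\<le>m div s. qbinom_it q m s i * bprod_s \<beta> n s i * f (n + int (i * s), m - i * s))"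
proof -
  let ?t = "\<lambda>j. qbinom q m j * step_inv s \<beta> (n, j) * f (n + int j, m - j)"
  have eq: "qbinom_it q m s i * bprod_s \<beta> n s i * f (n + int (i * s), m - i * s) = ?t (i * s)"
    if "i \<le> m div s" for i
  proof -
    have "i * s \<le> m" using assms that by (simp add: less_eq_div_iff_mult_less_eq)
    then have "qbinom q m (i * s) * qbinom_it q (i * s) s i = qbinom_it q m s i"
      by (simp add: qbinom_it_eq qbinom_def)
    then show ?thesis using assms by (simp add: step_inv_def flip: mult.assoc)
  qed
  have "qconv q (step_inv s \<beta>) f (n, m) = sum ?t {..m}" by (simp add: qconv_def)
  also have "\<dots> = sum ?t ((\<lambda>i. i * s) ` {..m div s})"
  proof (rule sum.mono_neutral_right)
    show "\<forall>j\<in>{..m} - (\<lambda>i. i * s) ` {..m div s}. ?t j = 0"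
    proof
      fix j assume j: "j \<in> {..m} - (\<lambda>i. i * s) ` {..m div s}"
      have "\<not> s dvd j"
      proof
        assume "s dvd j"
        then have "j = (j div s) * s" "j div s \<le> m div s" using j by (auto simp: div_le_mono)
        then show False using j by blast
      qed
      then show "?t j = 0" by (simp add: step_inv_def)
    qed
  qed (use assms in \<open>auto simp: less_eq_div_iff_mult_less_eq\<close>)
  also have "\<dots> = (\<Sum>i\<le>m div s. ?t (i * s))"
    using assms by (subst sum.reindex) (auto simp: inj_on_def)
  also have "\<dots> = (\<Sum>i\<le>m div s. qbinom_it q m s i * bprod_s \<beta> n s i * f (n + int (i * s), m - i * s))"
    by (rule sum.cong) (simp_all only: eq atMost_iff)
  finally show ?thesis .
qed

text \<open>One formula for all cases: for s = 1 substitute i = m - l, where the iterated q-binomial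
  becomes \<open>qfall\<close>; for m < s the sum is empty.\<close>

lemma phis_eq:
  assumes "s > 0"
  shows "phis q s \<beta> (n, m) = mon n m +
       (\<Sum>i\<in>{1..m div s}. smulv (qbinom_it q m s i)
          (smulv (bprod_s \<beta> n s i) (mon (n + int (i * s)) (m - i * s))
           - smulv (bprod_s \<beta> n s (i - 1) * \<beta> (n + int m - int s))
                   (mon (n + int (i * s) - int s) (m - i * s))))"
proof (cases "s = 1")
  case True
  have "phi1 q \<beta> (n, m) = mon n m + (\<Sum>i\<in>{1..m}. smulv (qbinom_it q m 1 i)
          (smulv (bprod_s \<beta> n 1 i) (mon (n + int i) (m - i))
           - smulv (bprod_s \<beta> n 1 (i - 1) * \<beta> (n + int m - 1)) (mon (n + int i - 1) (m - i))))"
    unfolding phi1_def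
    by (simp, rule sum.reindex_bij_witness[of _ "\<lambda>i. m - i" "\<lambda>i. m - i"])
       (auto simp: qbinom_it_eq qfall_eq bprod_def bprod_s_def of_nat_diff algebra_simps)
  then show ?thesis using True by (simp add: phis_def)
next
  case False
  then show ?thesis using assms by (auto simp: phis_def)
qed

lemma pull_phis_sum:
  assumes "s > 0"
  shows "pull (phis q s \<beta>) f (n, m) = f (n, m) + (\<Sum>i\<in>{1..m div s}. qbinom_it q m s i *
    (bprod_s \<beta> n s i * f (n + int (i * s), m - i * s) -
     bprod_s \<beta> n s (i - 1) * \<beta> (n + int m - int s) * f (n + int (i * s) - int s, m - i * s)))"
  by (simp add: pull_def phis_eq[OF assms])

text \<open>The positive terms together with f (n, m) form J f at (n, m). The negative terms, after
  shifting i by one, form J f at (n, m - s), weighted as right multiplication by 1 - N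
  requires.\<close>

lemma pull_phis:
  assumes "s > 0"
  shows "pull (phis q s \<beta>) f = qconv q (qconv q (step_inv s \<beta>) f) (step_elem s \<beta>)"
proof -
  have "pull (phis q s \<beta>) f (n, m) = qconv q (qconv q (step_inv s \<beta>) f) (step_elem s \<beta>) (n, m)" for n m
  proof -
    let ?c = "\<lambda>i. qbinom_it q m s i * bprod_s \<beta> n s i * f (n + int (i * s), m - i * s)"
    let ?d = "\<lambda>i. qbinom_it q m s i * (bprod_s \<beta> n s (i - 1) * \<beta> (n + int m - int s) * f (n + int (i * s) - int s, m - i * s))"
    have "pull (phis q s \<beta>) f (n, m) = f (n, m) + (\<Sum>i\<in>{1..m div s}. ?c i - ?d i)"
      by (simp add: pull_phis_sum[OF assms] algebra_simps)
    also have "\<dots> = (f (n, m) + sum ?c {1..m div s}) - sum ?d {1..m div s}"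
      by (simp add: sum_subtractf)
    also have "f (n, m) + sum ?c {1..m div s} = sum ?c {..m div s}"
      by (simp add: atMost_atLeast0 sum.atLeast_Suc_atMost)
    also have "sum ?d {1..m div s} =
      (if s \<le> m then qbinom q m s * \<beta> (n + int m - int s) * qconv q (step_inv s \<beta>) f (n, m - s) else 0)"
    proof (cases "s \<le> m")
      case True
      then have "m div s = Suc ((m - s) div s)" using assms by (simp add: le_div_geq)
      then have "sum ?d {1..m div s} = (\<Sum>i\<le>(m - s) div s. ?d (Suc i))"
        by (simp only: One_nat_def atMost_atLeast0 sum.shift_bounds_cl_Suc_ivl)
      also have "\<dots> = qbinom q m s * \<beta> (n + int m - int s) * qconv q (step_inv s \<beta>) f (n, m - s)"
        unfolding qconv_step_inv_left[OF assms] sum_distrib_left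
        by (rule sum.cong) (simp_all add: qbinom_it_Suc mult_ac)
      finally show ?thesis using True by simp
    qed simp
    finally show ?thesis
      by (simp only: qconv_step_elem_right[OF assms] qconv_step_inv_left[OF assms, of _ _ n m])
  qed
  then show ?thesis by auto
qed

lemma coalg_phis: "s > 0 \<Longrightarrow> coalg (phis q s \<beta>)"
  using coalg_inner[OF pull_phis] step_inverse by blast

lemma unitri_phis:
  assumes "s > 0"
  shows "unitri (phis q s \<beta>)"
  unfolding unitri_def
proof (intro allI impI)
  fix b c :: "int \<times> nat"
  assume "snd b \<le> snd c"
  obtain n m where b: "b = (n, m)" by (cases b)
  have mon: "Poly_Mapping.lookup (mon a (m - i * s)) c = (0::'k)" if "i \<in> {1..m div s}" for i a
  proof -
    have "0 < i * s" "0 < m" using that assms by (auto intro: gr0I)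
    then have "m - i * s < m" by (rule diff_less)
    with b \<open>snd b \<le> snd c\<close> show ?thesis by (auto simp: lookup_mon)
  qed
  have "Poly_Mapping.lookup (phis q s \<beta> b) c = Poly_Mapping.lookup (mon n m) c"
    unfolding b phis_eq[OF assms] lookup_add lookup_sum lookup_minus lookup_smulv
    by (subst sum.neutral) (use mon in auto)
  then show "Poly_Mapping.lookup (phis q s \<beta> b) c = (if b = c then 1 else 0)"
    by (auto simp: b lookup_mon)
qed

lemma phis_below: "m < s \<Longrightarrow> phis q s \<beta> (n, m) = mon n m"
  by (simp add: phis_eq)

text \<open>Degree s is the first in which the map can differ from the identity, and there \<beta>
  can be read off as the coefficient of x^(n+s).\<close>

lemma phis_diag:
  assumes "s > 0"
  shows "phis q s \<beta> (n, s) = mon n s + smulv (\<beta> n) (mon (n + int s) 0 - mon n 0)"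
  by (rule pairing_eqI)
     (use assms in \<open>simp add: phis_eq qbinom_it_def bprod_s_def algebra_simps\<close>)

end

section \<open>The group of coalgebra automorphisms\<close>

definition invH :: "'k::field linH \<Rightarrow> 'k linH" where
  "invH \<phi> = (\<lambda>(n, m). inv_into UNIV (lext \<phi>) (mon n m))"

lemma compH_invH:
  assumes "bij (lext \<phi>)"
  shows "compH \<phi> (invH \<phi>) = idH" "compH (invH \<phi>) \<phi> = idH"
proof -
  show 1: "compH \<phi> (invH \<phi>) = idH"
    using assms by (auto simp: compH_def invH_def idH_def fun_eq_iff bij_is_surj surj_f_inv_f)
  have "lext (invH \<phi>) (lext \<phi> v) = v" for v
    by (rule injD[OF bij_is_inj[OF assms]]) (simp add: 1 flip: lext_compH compH_assoc)
  then show "compH (invH \<phi>) \<phi> = idH"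
    by (intro lext_inject ext) (simp add: lext_compH)
qed

lemma bij_lextI: "compH \<phi> \<psi> = idH \<Longrightarrow> compH \<psi> \<phi> = idH \<Longrightarrow> bij (lext \<phi>)"
  by (rule o_bij[of "lext \<psi>"]) (rule ext, simp flip: lext_compH)+

lemma bij_lext_compH: "bij (lext \<phi>) \<Longrightarrow> bij (lext \<psi>) \<Longrightarrow> bij (lext (compH \<phi> \<psi>))"
  using bij_comp[of "lext \<psi>" "lext \<phi>"] by (simp add: lext_compH[abs_def] comp_def)

text \<open>Convolution at degree m only sees degrees up to m. This lets \<open>PhiG\<close> inherit
  multiplicativity from its finite truncations.\<close>

lemma qconv_cong:
  assumes "\<And>i. i \<le> m \<Longrightarrow> f (n, i) = f' (n, i)" "\<And>i. i \<le> m \<Longrightarrow> g (n + int i, m - i) = g' (n + int i, m - i)"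
  shows "qconv q f g (n, m) = qconv q f' g' (n, m)"
  using assms by (simp add: qconv_def)

definition delta :: "'a \<Rightarrow> 'a \<Rightarrow> 'k::field" where
  "delta c = (\<lambda>b. if b = c then 1 else 0)"

lemma pairing_delta [simp]: "pairing v (delta c) = Poly_Mapping.lookup v c"
  by (simp add: delta_def)

text \<open>Up to q-factorials the dual basis vectors multiply like the matrix units of the
  intervals from a to a + i.\<close>

lemma qconv_delta:
  "qconv q (delta (a, i)) (delta (a', j)) =
    (\<lambda>b. (if a' = a + int i then qbinom q (i + j) i else 0) * delta (a, i + j) b)"
proof -
  have "qconv q (delta (a, i)) (delta (a', j)) (n, m) =
    (if a' = a + int i then qbinom q (i + j) i else 0) * delta (a, i + j) (n, m)" for n m
  proof -
    have "qconv q (delta (a, i)) (delta (a', j)) (n, m) =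
      (\<Sum>k\<le>m. if k = i then qbinom q m i * delta (a, i) (n, i) * delta (a', j) (n + int i, m - i) else 0)"
      unfolding qconv_def prod.case by (rule sum.cong) (auto simp: delta_def)
    also have "\<dots> = (if a' = a + int i then qbinom q (i + j) i else 0) * delta (a, i + j) (n, m)"
      by (auto simp: delta_def)
    finally show ?thesis .
  qed
  then show ?thesis by auto
qed

lemma pairing_mult_const: "pairing v (\<lambda>b. c * f b) = c * pairing v f"
  by (simp add: pairing_def sum_distrib_left mult_ac)

lemma pairing_qconv_delta:
  "pairing v (qconv q (delta (a, i)) (delta (a', j))) =
    (if a' = a + int i then qbinom q (i + j) i * Poly_Mapping.lookup v (a, i + j) else 0)"
  by (simp add: qconv_delta pairing_mult_const)

context generic_q
begin

lemma qbinom_nz: "qbinom q m i \<noteq> 0"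
  by (simp add: qbinom_def)

section \<open>Closure of \<open>Aut_c\<close>, group-likes and skew-primitives\<close>

lemma Aut_c_compH: "\<phi> \<in> Aut_c q \<Longrightarrow> \<psi> \<in> Aut_c q \<Longrightarrow> compH \<phi> \<psi> \<in> Aut_c q"
  by (simp add: Aut_c_iff_coalg coalg_compH bij_lext_compH)

lemma Aut_c_idH: "idH \<in> Aut_c q"
  by (simp add: Aut_c_iff_coalg coalg_idH unitri_bij unitri_idH)

lemma Aut_c_invH:
  assumes "\<phi> \<in> Aut_c q"
  shows "invH \<phi> \<in> Aut_c q"
proof -
  have bij: "bij (lext \<phi>)" and coalg: "coalg \<phi>" using assms by (auto simp: Aut_c_iff_coalg)
  note inv = compH_invH[OF bij]
  have l: "pull \<phi> (pull (invH \<phi>) f) = f" for f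
    using arg_cong[OF inv(2), of "\<lambda>\<psi>. pull \<psi> f"] by simp
  have r: "pull (invH \<phi>) (pull \<phi> f) = f" for f
    using arg_cong[OF inv(1), of "\<lambda>\<psi>. pull \<psi> f"] by simp
  have "coalg (invH \<phi>)"
    using coalg unfolding coalg_def by (metis l r)
  then show ?thesis using bij_lextI[OF inv(2,1)] by (simp add: Aut_c_iff_coalg)
qed

text \<open>Pairing with the image of x^n is a multiplicative functional on the convolution algebra.
  It kills the matrix units of positive length, whose squares vanish, and takes the value 1 on
  exactly one of the orthogonal idempotents.\<close>

lemma grouplike_image:
  assumes "\<phi> \<in> Aut_c q"
  shows "\<exists>a. \<phi> (n, 0) = mon a 0"
proof -
  let ?V = "Poly_Mapping.lookup (\<phi> (n, 0))"
  have coalg: "coalg \<phi>" and inj: "inj (lext \<phi>)"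
    using assms by (auto simp: Aut_c_iff_coalg bij_is_inj)
  have "pairing (\<phi> (n, 0)) (qconv q f g) = pairing (\<phi> (n, 0)) f * pairing (\<phi> (n, 0)) g" for f g
    using coalg unfolding coalg_def pull_def by (simp add: fun_eq_iff qconv_def[of q "\<lambda>b. pairing (\<phi> b) f" for f])
  from this[of "delta (x, i)" "delta (y, j)" for x i y j]
  have V: "(if y = x + int i then qbinom q (i + j) i * ?V (x, i + j) else 0) = ?V (x, i) * ?V (y, j)" for x i y j
    by (simp add: pairing_qconv_delta)
  have long: "?V (x, l) = 0" if "l > 0" for x l
    using V[of x x l l] that by simp
  have "\<phi> (n, 0) \<noteq> 0"
  proof
    assume "\<phi> (n, 0) = 0"
    then have "mon n 0 = (0 :: 'k vecH)" using injD[OF inj, of "mon n 0" 0] by (simp add: lext_zero)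
    then have "Poly_Mapping.lookup (mon n 0 :: 'k vecH) (n, 0) = 0" by simp
    then show False by (simp add: lookup_mon)
  qed
  then obtain c where "?V c \<noteq> 0" by (metis lookup_zero poly_mapping_eqI)
  then obtain a where a: "?V (a, 0) \<noteq> 0" using long by (cases c) (metis gr0I)
  have "?V (a, 0) = 1" using V[of a a 0 0] a by simp
  moreover have "?V (x, 0) = 0" if "x \<noteq> a" for x using V[of x a 0 0] a that by simp
  ultimately have "?V c = Poly_Mapping.lookup (mon a 0) c" for c
    using long by (cases c; cases "snd c = 0") (auto simp: lookup_mon)
  then have "\<phi> (n, 0) = mon a 0" by (rule poly_mapping_eqI)
  then show ?thesis ..
qed

text \<open>The hypothesis says that \<open>v\<close> is skew-primitive between x^a and x^b. Testing
  it on pairs of matrix units leaves only the coefficients at x^a y, x^a and x^b.\<close>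

lemma skew_primitive:
  assumes "\<And>f g. pairing v (qconv q f g) = f (a, 0) * pairing v g + pairing v f * g (b, 0)"
  shows "\<exists>c d. v = smulv c (mon a 1) + smulv d (mon b 0 - mon a 0) \<and> (c \<noteq> 0 \<longrightarrow> b = a + 1)"
proof (intro exI conjI impI)
  let ?V = "Poly_Mapping.lookup v"
  have V: "(if y = x + int i then qbinom q (i + j) i * ?V (x, i + j) else 0) =
    delta (x, i) (a, 0) * ?V (y, j) + ?V (x, i) * delta (y, j) (b, 0)" for x i y j
    using assms[of "delta (x, i)" "delta (y, j)"] by (simp add: pairing_qconv_delta)
  have left: "?V (x, l) = 0" if "l > 0" "x \<noteq> a" for x l
    using V[of x x 0 l] that by (simp add: delta_def)
  have right: "?V (x, l) = 0" if "l > 0" "x + int l \<noteq> b" for x l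
    using V[of "x + int l" x l 0] that by (auto simp: delta_def)
  have long: "?V (x, Suc (Suc l)) = 0" for x l
    using V[of "x + 1" x 1 "Suc l"] qbinom_nz by (simp add: delta_def)
  have short: "?V (x, 0) = 0" if "x \<noteq> a" "x \<noteq> b" for x
    using V[of x x 0 0] that by (simp add: delta_def)
  \<comment> \<open>For a = b the relation below says that the coefficient equals twice itself; this
    forces it to vanish in every characteristic.\<close>
  have "(2::'k) \<noteq> 1"
    by (metis add_cancel_right_right one_add_one one_neq_zero)
  then have ends: "?V (a, 0) = (if a = b then 0 else - ?V (b, 0))"
    using V[of b a 0 0] by (auto simp: delta_def eq_neg_iff_add_eq_0 add.commute)
  show "v = smulv (?V (a, 1)) (mon a 1) + smulv (?V (b, 0)) (mon b 0 - mon a 0)"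
  proof (rule poly_mapping_eqI)
    fix c :: "int \<times> nat"
    obtain x l where c: "c = (x, l)" by (cases c)
    consider "l = 0" | "l = 1" | k where "l = Suc (Suc k)" by (metis One_nat_def not0_implies_Suc)
    then show "?V c = Poly_Mapping.lookup (smulv (?V (a, 1)) (mon a 1) + smulv (?V (b, 0)) (mon b 0 - mon a 0)) c"
      using left[of l x] short[of x] ends long
      by cases (auto simp: c lookup_add lookup_minus lookup_mon)
  qed
  show "b = a + 1" if "?V (a, 1) \<noteq> 0" using right[of 1 a] that by auto
qed

text \<open>Since \<open>Delta\<close> sends x^n y to x^n (x) x^n y + x^n y (x) x^(n+1), the image
  is skew-primitive between the images of the two group-likes.\<close>

lemma degree_one_image:
  assumes "coalg \<phi>" "\<phi> (n, 0) = mon a 0" "\<phi> (n + 1, 0) = mon b 0"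
  shows "\<exists>c d. \<phi> (n, 1) = smulv c (mon a 1) + smulv d (mon b 0 - mon a 0) \<and> (c \<noteq> 0 \<longrightarrow> b = a + 1)"
proof (rule skew_primitive)
  fix f g
  have "pairing (\<phi> (n, 1)) (qconv q f g) = qconv q (pull \<phi> f) (pull \<phi> g) (n, 1)"
    using assms(1) unfolding coalg_def by (metis pull_def)
  also have "\<dots> = f (a, 0) * pairing (\<phi> (n, 1)) g + pairing (\<phi> (n, 1)) f * g (b, 0)"
    using qbinom_self[of 1] by (simp add: qconv_def pull_def assms(2,3))
  finally show "pairing (\<phi> (n, 1)) (qconv q f g) =
    f (a, 0) * pairing (\<phi> (n, 1)) g + pairing (\<phi> (n, 1)) f * g (b, 0)" .
qed

text \<open>If the coefficient of x^(p n) y were zero, the image of x^n y would be a combination of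
  images of group-likes, against injectivity. So p (n + 1) = p n + 1 for all n, and p is a
  shift.\<close>

lemma Aut_c_shift:
  assumes "\<phi> \<in> Aut_c q"
  obtains r \<alpha> \<beta> where "\<And>n. \<phi> (n, 0) = mon (n + r) 0" "\<And>n. \<alpha> n \<noteq> 0"
    "\<And>n. \<phi> (n, 1) = smulv (\<alpha> n) (mon (n + r) 1) + smulv (\<beta> n) (mon (n + r + 1) 0 - mon (n + r) 0)"
proof -
  have coalg: "coalg \<phi>" and inj: "inj (lext \<phi>)"
    using assms by (auto simp: Aut_c_iff_coalg bij_is_inj)
  obtain p where p: "\<And>n. \<phi> (n, 0) = mon (p n) 0" using grouplike_image[OF assms] by metis
  have "\<exists>c d. \<phi> (n, 1) = smulv c (mon (p n) 1) + smulv d (mon (p (n + 1)) 0 - mon (p n) 0) \<and> c \<noteq> 0 \<and> p (n + 1) = p n + 1" for n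
  proof -
    obtain c d where cd: "\<phi> (n, 1) = smulv c (mon (p n) 1) + smulv d (mon (p (n + 1)) 0 - mon (p n) 0)"
      "c \<noteq> 0 \<longrightarrow> p (n + 1) = p n + 1"
      using degree_one_image[OF coalg p p] by blast
    have "c \<noteq> 0"
    proof
      assume "c = 0"
      then have "lext \<phi> (mon n 1) = lext \<phi> (smulv d (mon (n + 1) 0 - mon n 0))"
        using cd(1) by (intro pairing_eqI) (simp add: p pull_def)
      then have "mon n 1 = smulv d (mon (n + 1) 0 - mon n 0)" by (rule injD[OF inj])
      then have "Poly_Mapping.lookup (mon n 1 :: 'k vecH) (n, 1) = Poly_Mapping.lookup (smulv d (mon (n + 1) 0 - mon n 0)) (n, 1)"
        by simp
      then show False by (simp add: lookup_mon lookup_minus)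
    qed
    then show ?thesis using cd by blast
  qed
  then obtain \<alpha> \<beta> where \<alpha>: "\<And>n. \<alpha> n \<noteq> 0" and step: "\<And>n. p (n + 1) = p n + 1"
    and one: "\<And>n. \<phi> (n, 1) = smulv (\<alpha> n) (mon (p n) 1) + smulv (\<beta> n) (mon (p (n + 1)) 0 - mon (p n) 0)"
    by metis
  have shift: "p n = n + p 0" for n
  proof (induction n rule: int_induct[of _ 0])
    case (step2 i)
    then show ?case using step[of "i - 1"] by simp
  qed (use step in simp_all)
  show thesis
    by (rule that[of "p 0" \<alpha> \<beta>]) (simp_all only: p \<alpha> one step shift[symmetric] simp_thms)
qed

text \<open>Fixing the group-like 1 forces the shift to be trivial, so all x^n are fixed.\<close>

lemma Aut_star_iff:
  "\<phi> \<in> Aut_star q \<longleftrightarrow> \<phi> \<in> Aut_c q \<and> (\<forall>n. \<phi> (n, 0) = mon n 0) \<and>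
    (\<forall>n. \<exists>\<beta>. \<phi> (n, 1) = mon n 1 + smulv \<beta> (mon (n + 1) 0 - mon n 0))"
proof (intro iffI conjI)
  assume \<phi>: "\<phi> \<in> Aut_star q"
  then show c: "\<phi> \<in> Aut_c q" and star: "\<forall>n. \<exists>\<beta>. \<phi> (n, 1) = mon n 1 + smulv \<beta> (mon (n + 1) 0 - mon n 0)"
    by (auto simp: Aut_star_def Aut_0_def)
  have "\<phi> (0, 0) = mon 0 0" using \<phi> by (simp add: Aut_star_def Aut_0_def)
  obtain r where r: "\<And>n. \<phi> (n, 0) = mon (n + r) 0" using Aut_c_shift[OF c] by metis
  have "Poly_Mapping.lookup (\<phi> (0, 0)) (0, 0) = 1" using \<open>\<phi> (0, 0) = mon 0 0\<close> by (simp add: lookup_mon)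
  then have "r = 0" by (simp add: r lookup_mon split: if_splits)
  then show "\<forall>n. \<phi> (n, 0) = mon n 0" using r by simp
qed (auto simp: Aut_star_def Aut_0_def)

lemma Aut_star_compH:
  assumes "\<phi> \<in> Aut_star q" "\<psi> \<in> Aut_star q"
  shows "compH \<phi> \<psi> \<in> Aut_star q"
proof -
  have "\<exists>\<beta>. compH \<phi> \<psi> (n, 1) = mon n 1 + smulv \<beta> (mon (n + 1) 0 - mon n 0)" for n
  proof -
    obtain b c where "\<phi> (n, 1) = mon n 1 + smulv b (mon (n + 1) 0 - mon n 0)"
      "\<psi> (n, 1) = mon n 1 + smulv c (mon (n + 1) 0 - mon n 0)"
      using assms unfolding Aut_star_iff by blast
    then have "compH \<phi> \<psi> (n, 1) = mon n 1 + smulv (b + c) (mon (n + 1) 0 - mon n 0)"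
      using assms by (intro pairing_eqI) (simp add: Aut_star_iff compH_def pull_def algebra_simps)
    then show ?thesis ..
  qed
  then show ?thesis using assms by (auto simp: Aut_star_iff Aut_c_compH) (simp add: compH_def)
qed

lemma Aut_star_invH:
  assumes "\<phi> \<in> Aut_star q"
  shows "invH \<phi> \<in> Aut_star q"
proof -
  have "bij (lext \<phi>)" using assms by (simp add: Aut_star_iff Aut_c_iff_coalg)
  note inv = compH_invH(2)[OF this]
  have inv: "lext (invH \<phi>) (\<phi> (n, m)) = mon n m" for n m
    using fun_cong[OF inv, of "(n, m)"] by (simp add: compH_def idH_def)
  have 0: "invH \<phi> (n, 0) = mon n 0" for n
    using inv[of n 0] assms by (simp add: Aut_star_iff)
  have "\<exists>\<beta>. invH \<phi> (n, 1) = mon n 1 + smulv \<beta> (mon (n + 1) 0 - mon n 0)" for n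
  proof -
    obtain b where "\<phi> (n, 1) = mon n 1 + smulv b (mon (n + 1) 0 - mon n 0)"
      using assms by (auto simp: Aut_star_iff)
    then have eq: "mon n 1 = invH \<phi> (n, 1) + smulv b (mon (n + 1) 0 - mon n 0)"
      using inv[of n 1] by (simp add: lext_add lext_smulv lext_diff 0)
    have "invH \<phi> (n, 1) = mon n 1 - smulv b (mon (n + 1) 0 - mon n 0)"
      unfolding eq by simp
    also have "\<dots> = mon n 1 + smulv (- b) (mon (n + 1) 0 - mon n 0)"
      by (rule pairing_eqI) simp
    finally have "invH \<phi> (n, 1) = mon n 1 + smulv (- b) (mon (n + 1) 0 - mon n 0)" .
    then show ?thesis ..
  qed
  then show ?thesis using assms 0 by (auto simp: Aut_star_iff Aut_c_invH)
qed

lemma Aut_star_idH: "idH \<in> Aut_star q"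
proof -
  have "idH (n, 1) = mon n 1 + smulv 0 (mon (n + 1) 0 - mon n 0)" for n
    by (rule pairing_eqI) (simp add: idH_def)
  then show ?thesis unfolding Aut_star_iff by (auto simp: Aut_c_idH) (simp add: idH_def)
qed

lemma Aut_star_phis:
  assumes "s > 0"
  shows "phis q s \<beta> \<in> Aut_star q"
proof -
  have "\<exists>b. phis q s \<beta> (n, 1) = mon n 1 + smulv b (mon (n + 1) 0 - mon n 0)" for n
  proof (cases "s = 1")
    case True
    then show ?thesis using phis_diag[of 1 \<beta> n] by auto
  next
    case False
    then have "phis q s \<beta> (n, 1) = mon n 1 + smulv 0 (mon (n + 1) 0 - mon n 0)"
      using assms by (intro pairing_eqI) (simp add: phis_below)
    then show ?thesis ..
  qed
  then show ?thesis
    using assms by (simp add: Aut_star_iff Aut_c_iff_coalg coalg_phis unitri_bij unitri_phis phis_below)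
qed

section \<open>Bijectivity of \<open>\<Phi>\<close>\<close>

text \<open>A truncation with a fixed number of factors is one linear map, whereas
  \<open>PhiG\<close> changes the number of factors with the degree.\<close>

definition partial_Phi :: "nat \<Rightarrow> 'k Ginf \<Rightarrow> 'k linH" where
  "partial_Phi k B = foldr compH (map (\<lambda>i. phis q (Suc i) (B i)) [0..<k]) idH"

lemma foldr_compH: "foldr compH fs g = compH (foldr compH fs idH) (g :: 'k linH)"
  by (induction fs) (simp_all add: compH_assoc)

lemma partial_Phi_0 [simp]: "partial_Phi 0 B = idH"
  by (simp add: partial_Phi_def)

lemma partial_Phi_Suc: "partial_Phi (Suc k) B = compH (partial_Phi k B) (phis q (Suc k) (B k))"
  by (simp add: partial_Phi_def) (subst foldr_compH, simp)

lemma partial_Phi_cong: "(\<And>i. i < k \<Longrightarrow> B i = B' i) \<Longrightarrow> partial_Phi k B = partial_Phi k B'"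
  by (induction k) (simp_all add: partial_Phi_Suc)

lemma Aut_star_partial_Phi: "partial_Phi k B \<in> Aut_star q"
  by (induction k) (simp_all add: partial_Phi_Suc Aut_star_idH Aut_star_compH Aut_star_phis)

lemma unitri_partial_Phi: "unitri (partial_Phi k B)"
  by (induction k) (simp_all add: partial_Phi_Suc unitri_idH unitri_compH unitri_phis)

text \<open>Further factors act first and fix every monomial of degree at most k, so the truncations
  stabilise.\<close>

lemma partial_Phi_eq_PhiG: "m \<le> k \<Longrightarrow> partial_Phi k B (n, m) = PhiG q B (n, m)"
proof (induction k rule: dec_induct)
  case base
  show ?case by (cases m) (simp_all add: PhiG_def partial_Phi_def idH_def)
next
  case (step k)
  then show ?case by (simp add: partial_Phi_Suc compH_def phis_below)
qed

lemma unitri_PhiG: "unitri (PhiG q B)"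
  using unitri_partial_Phi[of _ B] unfolding unitri_def
  by (metis order_refl partial_Phi_eq_PhiG prod.collapse)

lemma PhiG_in_Aut_star: "PhiG q B \<in> Aut_star q"
proof -
  have pull: "pull (PhiG q B) f (n, m) = pull (partial_Phi k B) f (n, m)" if "m \<le> k" for f n m k
    using that by (simp add: pull_def partial_Phi_eq_PhiG)
  have coalg: "coalg (partial_Phi k B)" for k
    using Aut_star_partial_Phi[of k B] by (simp add: Aut_star_iff Aut_c_iff_coalg)
  have "pull (PhiG q B) (qconv q f g) (n, m) = qconv q (pull (PhiG q B) f) (pull (PhiG q B) g) (n, m)" for f g n m
  proof -
    have "pull (PhiG q B) (qconv q f g) (n, m) = qconv q (pull (partial_Phi m B) f) (pull (partial_Phi m B) g) (n, m)"
      using coalg[of m] by (simp add: pull[of m m] coalg_def)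
    also have "\<dots> = qconv q (pull (PhiG q B) f) (pull (PhiG q B) g) (n, m)"
      by (rule qconv_cong) (simp_all add: pull[of _ m])
    finally show ?thesis .
  qed
  moreover have "pull (PhiG q B) counit (n, m) = counit (n, m)" for n m
    using coalg[of m] by (simp add: pull[of m m] coalg_def)
  ultimately have "coalg (PhiG q B)" unfolding coalg_def by auto
  moreover have "PhiG q B (n, 1) = phis q 1 (B 0) (n, 1)" for n
    by (simp add: PhiG_def)
  ultimately show ?thesis
    using Aut_star_phis[of 1 "B 0"] by (auto simp: Aut_star_iff Aut_c_iff_coalg unitri_bij unitri_PhiG) (simp add: PhiG_def)
qed

text \<open>In the comultiplication of the difference the terms with 0 < i < s cancel, which makes
  it skew-primitive between x^n and x^(n+s). A term x^n y would require s = 1.\<close>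

lemma degree_image:
  assumes "coalg \<phi>" "s \<ge> 2" "\<And>n m. m < s \<Longrightarrow> \<phi> (n, m) = mon n m"
  shows "\<exists>d. \<phi> (n, s) = mon n s + smulv d (mon (n + int s) 0 - mon n 0)"
proof -
  let ?v = "\<phi> (n, s) - mon n s"
  have "pairing ?v (qconv q f g) = f (n, 0) * pairing ?v g + pairing ?v f * g (n + int s, 0)" for f g
  proof -
    have "pairing ?v (qconv q f g) = qconv q (pull \<phi> f) (pull \<phi> g) (n, s) - qconv q f g (n, s)"
      using assms(1) by (simp add: coalg_def fun_eq_iff pull_def)
    also have "\<dots> = (\<Sum>i\<le>s. qbinom q s i * (pull \<phi> f (n, i) * pull \<phi> g (n + int i, s - i) - f (n, i) * g (n + int i, s - i)))"
      by (simp add: qconv_def sum_subtractf algebra_simps)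
    also have "\<dots> = (\<Sum>i\<in>{0, s}. qbinom q s i * (pull \<phi> f (n, i) * pull \<phi> g (n + int i, s - i) - f (n, i) * g (n + int i, s - i)))"
      by (rule sum.mono_neutral_right) (auto simp: pull_def assms(3))
    also have "\<dots> = f (n, 0) * pairing ?v g + pairing ?v f * g (n + int s, 0)"
      using assms(2) by (simp add: pull_def assms(3) algebra_simps)
    finally show ?thesis .
  qed
  from skew_primitive[OF this] obtain c d
    where v: "?v = smulv c (mon n 1) + smulv d (mon (n + int s) 0 - mon n 0)" "c \<noteq> 0 \<longrightarrow> n + int s = n + 1"
    by blast
  have "c = 0" using v(2) assms(2) by auto
  have "\<phi> (n, s) = mon n s + ?v" by simp
  also have "\<dots> = mon n s + smulv d (mon (n + int s) 0 - mon n 0)"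
    unfolding v(1) \<open>c = 0\<close> by (rule pairing_eqI) simp
  finally show ?thesis ..
qed

text \<open>For s = 1 the shape is part of the definition of \<open>Aut_star\<close>; for larger s
  it comes from \<open>degree_image\<close>.\<close>

lemma Aut_star_leading:
  assumes "\<phi> \<in> Aut_star q" "s > 0" "\<And>n m. m < s \<Longrightarrow> \<phi> (n, m) = mon n m"
  shows "\<phi> (n, s) = phis q s (\<lambda>n. Poly_Mapping.lookup (\<phi> (n, s)) (n + int s, 0)) (n, s)"
proof -
  have "\<exists>d. \<phi> (n, s) = mon n s + smulv d (mon (n + int s) 0 - mon n 0)"
  proof (cases "s = 1")
    case True
    then show ?thesis using assms(1) by (simp add: Aut_star_iff)
  next
    case False
    then show ?thesis using assms by (intro degree_image) (auto simp: Aut_star_iff Aut_c_iff_coalg)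
  qed
  then obtain d where d: "\<phi> (n, s) = mon n s + smulv d (mon (n + int s) 0 - mon n 0)" ..
  then have "Poly_Mapping.lookup (\<phi> (n, s)) (n + int s, 0) = d"
    using assms(2) by (simp add: lookup_add lookup_minus lookup_mon)
  then show ?thesis using d assms(2) by (simp add: phis_diag)
qed

text \<open>What remains after removing k factors on the left. The sequence for the next factor is
  read off in degree k + 1.\<close>

primrec residual :: "'k linH \<Rightarrow> nat \<Rightarrow> 'k linH" where
  "residual \<phi> 0 = \<phi>"
| "residual \<phi> (Suc k) = compH (invH (phis q (Suc k)
     (\<lambda>n. Poly_Mapping.lookup (residual \<phi> k (n, Suc k)) (n + int (Suc k), 0)))) (residual \<phi> k)"

definition coordinates :: "'k linH \<Rightarrow> 'k Ginf" where
  "coordinates \<phi> k = (\<lambda>n. Poly_Mapping.lookup (residual \<phi> k (n, Suc k)) (n + int (Suc k), 0))"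

lemma residual_properties:
  assumes "\<phi> \<in> Aut_star q"
  shows "residual \<phi> k \<in> Aut_star q \<and> (\<forall>n m. m \<le> k \<longrightarrow> residual \<phi> k (n, m) = mon n m) \<and>
    compH (partial_Phi k (coordinates \<phi>)) (residual \<phi> k) = \<phi>"
proof (induction k)
  case 0
  then show ?case using assms by (simp add: Aut_star_iff)
next
  case (Suc k)
  let ?p = "phis q (Suc k) (coordinates \<phi> k)"
  have p: "?p \<in> Aut_star q" by (simp add: Aut_star_phis)
  then have "bij (lext ?p)" by (simp add: Aut_star_iff Aut_c_iff_coalg)
  note inv = compH_invH[OF this]
  have res: "residual \<phi> (Suc k) = compH (invH ?p) (residual \<phi> k)"
    by (simp add: coordinates_def)
  \<comment> \<open>The residual agrees with the next factor up to degree k + 1, so removing that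
    factor leaves the identity in those degrees.\<close>
  have "residual \<phi> k (n, m) = ?p (n, m)" if "m \<le> Suc k" for n m
  proof (cases "m = Suc k")
    case True
    have "residual \<phi> k (n, Suc k) = phis q (Suc k)
        (\<lambda>n. Poly_Mapping.lookup (residual \<phi> k (n, Suc k)) (n + int (Suc k), 0)) (n, Suc k)"
      using Suc by (intro Aut_star_leading) auto
    then show ?thesis unfolding True coordinates_def .
  next
    case False
    then show ?thesis using Suc that by (simp add: phis_below)
  qed
  then have "residual \<phi> (Suc k) (n, m) = mon n m" if "m \<le> Suc k" for n m
    using fun_cong[OF inv(2), of "(n, m)"] that unfolding res by (simp add: compH_def idH_def)
  moreover have "compH (partial_Phi (Suc k) (coordinates \<phi>)) (residual \<phi> (Suc k)) =
      compH (partial_Phi k (coordinates \<phi>)) (compH (compH ?p (invH ?p)) (residual \<phi> k))"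
    unfolding res partial_Phi_Suc by (simp add: compH_assoc)
  then have "compH (partial_Phi (Suc k) (coordinates \<phi>)) (residual \<phi> (Suc k)) = \<phi>"
    using Suc by (simp add: inv)
  moreover have "residual \<phi> (Suc k) \<in> Aut_star q"
    unfolding res using Suc p by (intro Aut_star_compH Aut_star_invH) auto
  ultimately show ?case by blast
qed

lemma PhiG_coordinates:
  assumes "\<phi> \<in> Aut_star q"
  shows "PhiG q (coordinates \<phi>) = \<phi>"
proof -
  have "PhiG q (coordinates \<phi>) (n, m) = \<phi> (n, m)" for n m
  proof -
    have res: "residual \<phi> m (n, m) = mon n m" and eq: "compH (partial_Phi m (coordinates \<phi>)) (residual \<phi> m) = \<phi>"
      using residual_properties[OF assms, of m] by auto
    have "\<phi> (n, m) = lext (partial_Phi m (coordinates \<phi>)) (residual \<phi> m (n, m))"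
      using fun_cong[OF eq, of "(n, m)"] by (simp only: compH_def)
    also have "\<dots> = PhiG q (coordinates \<phi>) (n, m)"
      by (simp add: res partial_Phi_eq_PhiG)
    finally show ?thesis by (rule sym)
  qed
  then show ?thesis by auto
qed

text \<open>By strong induction the truncations before index k coincide and cancel by injectivity;
  the next factors are then compared at x^(n+k+1).\<close>

lemma PhiG_inject:
  assumes "PhiG q B = PhiG q B'"
  shows "B = B'"
proof
  fix k
  show "B k = B' k"
  proof (induction k rule: less_induct)
    case (less k)
    have "inj (lext (partial_Phi k B))"
      using Aut_star_partial_Phi[of k B] by (simp add: Aut_star_iff Aut_c_iff_coalg bij_is_inj)
    moreover have "lext (partial_Phi k B) (phis q (Suc k) (B k) (n, Suc k)) =
        lext (partial_Phi k B) (phis q (Suc k) (B' k) (n, Suc k))" for n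
    proof -
      have "partial_Phi (Suc k) B (n, Suc k) = partial_Phi (Suc k) B' (n, Suc k)"
        by (simp add: partial_Phi_eq_PhiG assms)
      moreover have "partial_Phi k B' = partial_Phi k B"
        by (rule partial_Phi_cong) (simp add: less)
      ultimately show ?thesis by (simp add: partial_Phi_Suc compH_def)
    qed
    ultimately have "phis q (Suc k) (B k) (n, Suc k) = phis q (Suc k) (B' k) (n, Suc k)" for n
      by (rule injD)
    then have "Poly_Mapping.lookup (phis q (Suc k) (B k) (n, Suc k)) (n + int (Suc k), 0) =
        Poly_Mapping.lookup (phis q (Suc k) (B' k) (n, Suc k)) (n + int (Suc k), 0)" for n
      by simp
    then show ?case
      by (simp add: phis_diag lookup_add lookup_minus lookup_mon fun_eq_iff)
  qed
qed

lemma bij_PhiG: "bij_betw (PhiG q) UNIV (Aut_star q)"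
  unfolding bij_betw_def using PhiG_inject PhiG_in_Aut_star PhiG_coordinates
  by (auto intro!: injI) (metis rangeI)

end

section \<open>The semidirect product decomposition\<close>

text \<open>Treating \<phi>_\<alpha> \<theta>_r as one map makes it a homomorphism on
  \<open>UnitsZ\<close>.\<close>

definition twist :: "(int \<Rightarrow> 'k::field) \<times> int \<Rightarrow> 'k linH" where
  "twist \<kappa> = compH (phi_alpha (fst \<kappa>)) (thetaH (snd \<kappa>))"

lemma twist_apply: "twist (\<alpha>, r) (n, m) = smulv (bprod \<alpha> (n + r) m) (mon (n + r) m)"
  by (simp add: twist_def compH_def thetaH_def phi_alpha_def bprod_def)

lemma pull_twist: "pull (twist (\<alpha>, r)) f (n, m) = bprod \<alpha> (n + r) m * f (n + r, m)"
  by (simp add: pull_def twist_apply)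

lemma bprod_add: "bprod \<alpha> n (i + k) = bprod \<alpha> n i * bprod \<alpha> (n + int i) k"
  by (induction k) (simp_all add: bprod_def add.assoc)

lemma bprod_0 [simp]: "bprod \<alpha> n 0 = 1"
  by (simp add: bprod_def)

lemma bprod_mult: "bprod (\<lambda>n. \<alpha> n * \<beta> (n - r)) n m = bprod \<alpha> n m * bprod \<beta> (n - r) m"
  by (simp add: bprod_def prod.distrib algebra_simps)

lemma bprod_nz: "(\<And>n. \<alpha> n \<noteq> 0) \<Longrightarrow> bprod \<alpha> n m \<noteq> 0"
  by (simp add: bprod_def)

lemma twist_mult: "twist (\<kappa> \<otimes>\<^bsub>UnitsZ\<^esub> \<kappa>') = compH (twist \<kappa>) (twist \<kappa>')"
proof -
  obtain \<alpha> r \<beta> t where \<kappa>: "\<kappa> = (\<alpha>, r)" "\<kappa>' = (\<beta>, t)" by (cases \<kappa>; cases \<kappa>')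
  have "twist (\<kappa> \<otimes>\<^bsub>UnitsZ\<^esub> \<kappa>') (n, m) = compH (twist \<kappa>) (twist \<kappa>') (n, m)" for n m
    by (rule pairing_eqI)
       (simp add: \<kappa> UnitsZ_def twist_apply compH_def lext_smulv bprod_mult algebra_simps)
  then show ?thesis by auto
qed

lemma twist_one: "twist \<one>\<^bsub>UnitsZ\<^esub> = idH"
  by (auto simp: UnitsZ_def twist_apply idH_def bprod_def fun_eq_iff)

text \<open>The index shift comes from solving \<alpha> \<beta>[-r] = 1 for \<beta>.\<close>

definition UnitsZ_inv :: "(int \<Rightarrow> 'k::field) \<times> int \<Rightarrow> (int \<Rightarrow> 'k) \<times> int" where
  "UnitsZ_inv = (\<lambda>(\<alpha>, r). (\<lambda>n. inverse (\<alpha> (n + r)), - r))"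

lemma UnitsZ_inv:
  assumes "\<kappa> \<in> carrier UnitsZ"
  shows "UnitsZ_inv \<kappa> \<in> carrier UnitsZ" "\<kappa> \<otimes>\<^bsub>UnitsZ\<^esub> UnitsZ_inv \<kappa> = \<one>\<^bsub>UnitsZ\<^esub>"
    "UnitsZ_inv \<kappa> \<otimes>\<^bsub>UnitsZ\<^esub> \<kappa> = \<one>\<^bsub>UnitsZ\<^esub>"
  using assms by (auto simp: UnitsZ_def UnitsZ_inv_def)

lemma twist_inverse:
  assumes "\<kappa> \<in> carrier UnitsZ"
  shows "compH (twist \<kappa>) (twist (UnitsZ_inv \<kappa>)) = idH" "compH (twist (UnitsZ_inv \<kappa>)) (twist \<kappa>) = idH"
  using UnitsZ_inv[OF assms] by (simp_all add: twist_one flip: twist_mult)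

lemma actG_one: "actG \<one>\<^bsub>UnitsZ\<^esub> B = B"
  by (simp add: actG_def UnitsZ_def)

lemma actG_mult: "actG (\<kappa> \<otimes>\<^bsub>UnitsZ\<^esub> \<kappa>') B = actG \<kappa> (actG \<kappa>' B)"
  by (cases \<kappa>; cases \<kappa>')
     (simp add: actG_def UnitsZ_def fun_eq_iff prod.distrib algebra_simps del: prod.lessThan_Suc)

context generic_q
begin

text \<open>Multiplicativity is the cocycle rule \<open>bprod_add\<close>: products of \<alpha> over
  adjacent intervals concatenate.\<close>

lemma twist_Aut_c:
  assumes "\<kappa> \<in> carrier UnitsZ"
  shows "twist \<kappa> \<in> Aut_c q"
proof -
  obtain \<alpha> r where \<kappa>: "\<kappa> = (\<alpha>, r)" by (cases \<kappa>)
  have "pull (twist \<kappa>) (qconv q f g) (n, m) = qconv q (pull (twist \<kappa>) f) (pull (twist \<kappa>) g) (n, m)" for f g n m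
  proof -
    have "bprod \<alpha> (n + r) m = bprod \<alpha> (n + r) i * bprod \<alpha> (n + int i + r) (m - i)" if "i \<le> m" for i
      using bprod_add[of \<alpha> "n + r" i "m - i"] that by (simp add: algebra_simps)
    then show ?thesis
      by (auto simp: \<kappa> pull_twist qconv_def sum_distrib_left algebra_simps intro!: sum.cong)
  qed
  moreover have "pull (twist \<kappa>) counit (n, m) = counit (n, m)" for n m
    by (simp add: \<kappa> pull_twist counit_def)
  ultimately show ?thesis
    using bij_lextI[OF twist_inverse[OF assms]] by (auto simp: Aut_c_iff_coalg coalg_def)
qed

text \<open>The product of \<alpha> is cut into blocks of length s, and each block cancels the
  inverse in one factor of \<beta>'.\<close>

lemma bprod_s_scaled:
  assumes "\<And>n. \<alpha> n \<noteq> 0" "\<And>k. \<beta>' k = inverse (bprod \<alpha> k s) * \<beta> (k - r)"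
  shows "bprod \<alpha> n (i * s) * bprod_s \<beta>' n s i = bprod_s \<beta> (n - r) s i"
proof (induction i)
  case (Suc i)
  let ?b = "bprod \<alpha> (n + int (i * s)) s"
  have "bprod \<alpha> n (Suc i * s) = bprod \<alpha> n (i * s) * ?b"
    using bprod_add[of \<alpha> n "i * s" s] by (simp add: add.commute)
  then have "bprod \<alpha> n (Suc i * s) * bprod_s \<beta>' n s (Suc i) =
      (bprod \<alpha> n (i * s) * bprod_s \<beta>' n s i) * (?b * inverse ?b) * \<beta> (n + int (i * s) - r)"
    by (simp only: bprod_s_Suc' assms(2)[of "n + int (i * s)"] mult_ac)
  also have "\<dots> = bprod_s \<beta> (n - r) s (Suc i)"
    using bprod_nz[OF assms(1)]
    by (simp only: Suc.IH right_inverse mult_1_right bprod_s_Suc') (simp add: algebra_simps)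
  finally show ?case .
qed simp

text \<open>This commutation rule dictates the formula for \<open>actG\<close>. It is checked term
  by term on transposes.\<close>

lemma phis_twist:
  assumes "s > 0" "\<And>n. \<alpha> n \<noteq> 0" "\<And>k. \<beta>' k = inverse (bprod \<alpha> k s) * \<beta> (k - r)"
  shows "compH (phis q s \<beta>') (twist (\<alpha>, r)) = compH (twist (\<alpha>, r)) (phis q s \<beta>)"
proof (rule pull_inject, rule ext)
  fix f
  have "pull (compH (phis q s \<beta>') (twist (\<alpha>, r))) f (n, m) =
        pull (compH (twist (\<alpha>, r)) (phis q s \<beta>)) f (n, m)" for n m
  proof -
    let ?N = "n + r"
    have "bprod \<alpha> ?N m * (bprod_s \<beta>' ?N s i * f (?N + int (i * s), m - i * s) -
        bprod_s \<beta>' ?N s (i - 1) * \<beta>' (?N + int m - int s) * f (?N + int (i * s) - int s, m - i * s))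
      = bprod_s \<beta> n s i * (bprod \<alpha> (n + int (i * s) + r) (m - i * s) * f (n + int (i * s) + r, m - i * s)) -
        bprod_s \<beta> n s (i - 1) * \<beta> (n + int m - int s) *
          (bprod \<alpha> (n + int (i * s) - int s + r) (m - i * s) * f (n + int (i * s) - int s + r, m - i * s))"
      if "i \<in> {1..m div s}" for i
    proof -
      from that obtain j where j: "i = Suc j" by (cases i) auto
      from that assms(1) have "i * s \<le> m" by (simp add: less_eq_div_iff_mult_less_eq)
      then obtain l where l: "m = i * s + l" using le_Suc_ex by blast
      have 1: "bprod \<alpha> ?N m * bprod_s \<beta>' ?N s i = bprod \<alpha> (?N + int (i * s)) l * bprod_s \<beta> n s i"
        using bprod_s_scaled[OF assms(2,3), of ?N i] by (simp add: l bprod_add mult_ac)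
      \<comment> \<open>Because m = j s + l + s, the last block of length s can be isolated; it
        cancels the inverse in the factor \<beta>' at N + m - s.\<close>
      have "bprod \<alpha> ?N m = bprod \<alpha> ?N (j * s) * bprod \<alpha> (?N + int (j * s)) l * bprod \<alpha> (?N + int m - int s) s"
        using bprod_add[of \<alpha> ?N "j * s" "l + s"] bprod_add[of \<alpha> "?N + int (j * s)" l s]
        by (simp add: l j algebra_simps)
      then have "bprod \<alpha> ?N m * (bprod_s \<beta>' ?N s j * \<beta>' (?N + int m - int s)) =
          (bprod \<alpha> ?N (j * s) * bprod_s \<beta>' ?N s j) * bprod \<alpha> (?N + int (j * s)) l *
          (bprod \<alpha> (?N + int m - int s) s * inverse (bprod \<alpha> (?N + int m - int s) s)) * \<beta> (?N + int m - int s - r)"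
        by (simp only: assms(3)[of "?N + int m - int s"] mult_ac)
      moreover have "bprod \<alpha> (?N + int m - int s) s \<noteq> 0" using assms(2) by (rule bprod_nz)
      moreover have "?N + int m - int s - r = n + int m - int s" by simp
      ultimately have 2: "bprod \<alpha> ?N m * (bprod_s \<beta>' ?N s j * \<beta>' (?N + int m - int s)) =
          bprod \<alpha> (?N + int (j * s)) l * (bprod_s \<beta> n s j * \<beta> (n + int m - int s))"
        using bprod_s_scaled[OF assms(2,3), of ?N j] by (simp only: right_inverse mult_1_right mult_ac) simp
      have first: "bprod \<alpha> ?N m * (bprod_s \<beta>' ?N s i * F) = bprod_s \<beta> n s i * (bprod \<alpha> (?N + int (i * s)) l * F)" for F
        using arg_cong[OF 1, of "\<lambda>x. x * F"] by (simp only: mult_ac)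
      have second: "bprod \<alpha> ?N m * (bprod_s \<beta>' ?N s j * \<beta>' (?N + int m - int s) * F) =
          bprod_s \<beta> n s j * \<beta> (n + int m - int s) * (bprod \<alpha> (?N + int (j * s)) l * F)" for F
        using arg_cong[OF 2, of "\<lambda>x. x * F"] by (simp only: mult_ac)
      have idx: "n + int (i * s) + r = ?N + int (i * s)" "n + int (i * s) - int s + r = ?N + int (j * s)"
        "?N + int (i * s) - int s = ?N + int (j * s)" "m - i * s = l" "i - 1 = j"
        by (simp_all add: j l algebra_simps)
      show ?thesis
        by (simp only: idx right_diff_distrib first second)
    qed
    then show ?thesis
      by (simp only: pull_compH pull_twist pull_phis_sum[OF assms(1)] distrib_left sum_distrib_left
          mult.left_commute[of "bprod \<alpha> ?N m" "qbinom_it q m s i" for i] cong: sum.cong)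
  qed
  then show "pull (compH (phis q s \<beta>') (twist (\<alpha>, r))) f = pull (compH (twist (\<alpha>, r)) (phis q s \<beta>)) f"
    by auto
qed

lemma partial_Phi_twist:
  assumes "\<kappa> \<in> carrier UnitsZ"
  shows "compH (partial_Phi k (actG \<kappa> B)) (twist \<kappa>) = compH (twist \<kappa>) (partial_Phi k B)"
proof (induction k)
  case (Suc k)
  obtain \<alpha> r where \<kappa>: "\<kappa> = (\<alpha>, r)" "\<And>n. \<alpha> n \<noteq> 0" using assms by (auto simp: UnitsZ_def)
  have "compH (phis q (Suc k) (actG \<kappa> B k)) (twist \<kappa>) = compH (twist \<kappa>) (phis q (Suc k) (B k))"
    unfolding \<kappa>(1) using \<kappa>(2)
    by (intro phis_twist) (simp_all add: actG_def bprod_def comp_def del: prod.lessThan_Suc flip: prod_inversef)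
  then show ?case by (simp add: partial_Phi_Suc compH_assoc) (simp add: Suc flip: compH_assoc)
qed simp

text \<open>A twist preserves the degree in y, so in degree m both sides are computed by the
  truncation to m factors.\<close>

lemma PhiG_twist:
  assumes "\<kappa> \<in> carrier UnitsZ"
  shows "compH (PhiG q (actG \<kappa> B)) (twist \<kappa>) = compH (twist \<kappa>) (PhiG q B)"
proof -
  obtain \<alpha> r where \<kappa>: "\<kappa> = (\<alpha>, r)" by (cases \<kappa>)
  have "compH (PhiG q (actG \<kappa> B)) (twist \<kappa>) (n, m) = compH (twist \<kappa>) (PhiG q B) (n, m)" for n m
  proof -
    have "compH (PhiG q (actG \<kappa> B)) (twist \<kappa>) (n, m) = compH (partial_Phi m (actG \<kappa> B)) (twist \<kappa>) (n, m)"
      by (simp add: \<kappa> compH_def twist_apply lext_smulv partial_Phi_eq_PhiG)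
    also have "\<dots> = compH (twist \<kappa>) (PhiG q B) (n, m)"
      unfolding partial_Phi_twist[OF assms] by (simp add: compH_def partial_Phi_eq_PhiG)
    finally show ?thesis .
  qed
  then show ?thesis by auto
qed

section \<open>The transported group structure and the semidirect products\<close>

lemma PhiG_mult: "PhiG q (g \<otimes>\<^bsub>GinfG q\<^esub> h) = compH (PhiG q g) (PhiG q h)"
  unfolding GinfG_def using bij_PhiG Aut_star_compH[OF PhiG_in_Aut_star PhiG_in_Aut_star]
  by (simp add: bij_betw_def f_the_inv_into_f)

lemma PhiG_one: "PhiG q \<one>\<^bsub>GinfG q\<^esub> = idH"
  unfolding GinfG_def using bij_PhiG Aut_star_idH by (simp add: bij_betw_def f_the_inv_into_f)

lemma carrier_GinfG [simp]: "carrier (GinfG q) = UNIV"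
  by (simp add: GinfG_def)

lemma group_GinfG: "group (GinfG q)"
proof (rule groupI)
  fix g
  have "PhiG q (coordinates (invH (PhiG q g))) = invH (PhiG q g)"
    by (simp add: PhiG_coordinates Aut_star_invH PhiG_in_Aut_star)
  moreover have "bij (lext (PhiG q g))"
    by (simp add: unitri_bij unitri_PhiG)
  ultimately have "coordinates (invH (PhiG q g)) \<otimes>\<^bsub>GinfG q\<^esub> g = \<one>\<^bsub>GinfG q\<^esub>"
    by (intro PhiG_inject) (simp add: PhiG_mult PhiG_one compH_invH)
  then show "\<exists>h\<in>carrier (GinfG q). h \<otimes>\<^bsub>GinfG q\<^esub> g = \<one>\<^bsub>GinfG q\<^esub>" by auto
qed (auto intro!: PhiG_inject simp: PhiG_mult PhiG_one compH_assoc)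

lemma twist_cancel:
  assumes "\<kappa> \<in> carrier UnitsZ" "compH \<phi> (twist \<kappa>) = compH \<psi> (twist \<kappa>)"
  shows "\<phi> = \<psi>"
  using arg_cong[OF assms(2), of "\<lambda>\<chi>. compH \<chi> (twist (UnitsZ_inv \<kappa>))"]
  by (simp add: compH_assoc twist_inverse[OF assms(1)])

text \<open>Under \<open>PhiG\<close> the action is conjugation by \<open>twist \<kappa>\<close>,
  hence compatible with products.\<close>

lemma actG_hom:
  assumes "\<kappa> \<in> carrier UnitsZ"
  shows "actG \<kappa> (g \<otimes>\<^bsub>GinfG q\<^esub> h) = actG \<kappa> g \<otimes>\<^bsub>GinfG q\<^esub> actG \<kappa> h"
proof (rule PhiG_inject, rule twist_cancel[OF assms])
  have "compH (PhiG q (actG \<kappa> (g \<otimes>\<^bsub>GinfG q\<^esub> h))) (twist \<kappa>) = compH (compH (twist \<kappa>) (PhiG q g)) (PhiG q h)"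
    by (simp add: PhiG_twist[OF assms] PhiG_mult compH_assoc)
  also have "\<dots> = compH (PhiG q (actG \<kappa> g)) (compH (twist \<kappa>) (PhiG q h))"
    unfolding PhiG_twist[OF assms, of g, symmetric] by (rule compH_assoc)
  also have "\<dots> = compH (PhiG q (actG \<kappa> g \<otimes>\<^bsub>GinfG q\<^esub> actG \<kappa> h)) (twist \<kappa>)"
    by (simp only: PhiG_twist[OF assms, symmetric] PhiG_mult compH_assoc)
  finally show "compH (PhiG q (actG \<kappa> (g \<otimes>\<^bsub>GinfG q\<^esub> h))) (twist \<kappa>) =
      compH (PhiG q (actG \<kappa> g \<otimes>\<^bsub>GinfG q\<^esub> actG \<kappa> h)) (twist \<kappa>)" .
qed

lemma actG_iso:
  assumes "\<kappa> \<in> carrier UnitsZ"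
  shows "actG \<kappa> \<in> iso (GinfG q) (GinfG q)"
proof -
  have "bij (actG \<kappa>)"
    by (rule o_bij[of "actG (UnitsZ_inv \<kappa>)"])
       (rule ext, simp add: UnitsZ_inv[OF assms] actG_one flip: actG_mult)+
  then show ?thesis by (simp add: iso_def hom_def actG_hom[OF assms])
qed

lemma semidirect_hom:
  assumes "\<kappa> \<in> carrier UnitsZ"
  shows "compH (PhiG q (g \<otimes>\<^bsub>GinfG q\<^esub> actG \<kappa> g')) (twist (\<kappa> \<otimes>\<^bsub>UnitsZ\<^esub> \<kappa>')) =
    compH (compH (PhiG q g) (twist \<kappa>)) (compH (PhiG q g') (twist \<kappa>'))"
proof -
  have "compH (PhiG q (g \<otimes>\<^bsub>GinfG q\<^esub> actG \<kappa> g')) (twist (\<kappa> \<otimes>\<^bsub>UnitsZ\<^esub> \<kappa>')) =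
      compH (PhiG q g) (compH (compH (PhiG q (actG \<kappa> g')) (twist \<kappa>)) (twist \<kappa>'))"
    by (simp add: PhiG_mult twist_mult compH_assoc)
  then show ?thesis by (simp add: PhiG_twist[OF assms] compH_assoc)
qed

lemma PhiG_0: "PhiG q g (n, 0) = mon n 0"
  by (simp add: PhiG_def)

text \<open>The image of 1 gives the shift. The coefficient of x^n y, which the unitriangular factor
  does not disturb, gives \<alpha>; then the twist cancels.\<close>

lemma semidirect_inject:
  assumes "compH (PhiG q g) (twist \<kappa>) = compH (PhiG q g') (twist \<kappa>')" "\<kappa> \<in> carrier UnitsZ"
  shows "g = g' \<and> \<kappa> = \<kappa>'"
proof -
  obtain \<alpha> r \<beta> t where \<kappa>: "\<kappa> = (\<alpha>, r)" "\<kappa>' = (\<beta>, t)" by (cases \<kappa>; cases \<kappa>')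
  have eq: "smulv (bprod \<alpha> (n + r) m) (PhiG q g (n + r, m)) = smulv (bprod \<beta> (n + t) m) (PhiG q g' (n + t, m))" for n m
    using fun_cong[OF assms(1), of "(n, m)"] by (simp add: \<kappa> compH_def twist_apply lext_smulv)
  have "mon r 0 = (mon t 0 :: 'k vecH)" using eq[of 0 0] by (simp add: PhiG_0)
  then have "Poly_Mapping.keys (mon r 0 :: 'k vecH) = Poly_Mapping.keys (mon t 0 :: 'k vecH)" by (rule arg_cong)
  then have rt: "r = t" by simp
  have "\<alpha> n = \<beta> n" for n
    using arg_cong[OF eq[of "n - r" 1], of "\<lambda>v. Poly_Mapping.lookup v (n, 1)"] unitri_PhiG[of g] unitri_PhiG[of g']
    by (simp add: rt unitri_def bprod_def)
  then have "\<kappa> = \<kappa>'" using rt by (auto simp: \<kappa>)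
  then show ?thesis using assms twist_cancel PhiG_inject by metis
qed

text \<open>Dividing by the twist found in \<open>Aut_c_shift\<close> leaves an element of
  \<open>Aut_star\<close>, which has coordinates.\<close>

lemma semidirect_surj:
  assumes "\<phi> \<in> Aut_c q"
  obtains g \<kappa> where "\<kappa> \<in> carrier UnitsZ" "\<phi> = compH (PhiG q g) (twist \<kappa>)"
proof -
  obtain r a b where 0: "\<And>n. \<phi> (n, 0) = mon (n + r) 0" and a: "\<And>n. a n \<noteq> 0"
    and 1: "\<And>n. \<phi> (n, 1) = smulv (a n) (mon (n + r) 1) + smulv (b n) (mon (n + r + 1) 0 - mon (n + r) 0)"
    using Aut_c_shift[OF assms] by blast
  \<comment> \<open>The scalars \<open>a\<close> are indexed by the exponent before the shift, while
    a twist scales after shifting.\<close>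
  define \<kappa> where "\<kappa> = (\<lambda>n. a (n - r), r)"
  have \<kappa>: "\<kappa> \<in> carrier UnitsZ" by (simp add: \<kappa>_def UnitsZ_def a)
  have inv: "UnitsZ_inv \<kappa> = (\<lambda>n. inverse (a n), - r)" by (simp add: \<kappa>_def UnitsZ_inv_def)
  define \<psi> where "\<psi> = compH \<phi> (twist (UnitsZ_inv \<kappa>))"
  have "\<psi> \<in> Aut_c q"
    unfolding \<psi>_def by (intro Aut_c_compH assms twist_Aut_c UnitsZ_inv(1) \<kappa>)
  moreover have "\<psi> (n, 0) = mon n 0" for n
    by (simp add: \<psi>_def compH_def inv twist_apply lext_smulv 0)
  moreover have "\<psi> (n, 1) = mon n 1 + smulv (inverse (a (n - r)) * b (n - r)) (mon (n + 1) 0 - mon n 0)" for n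
  proof -
    have "\<psi> (n, 1) = smulv (inverse (a (n - r))) (\<phi> (n - r, 1))"
      by (simp add: \<psi>_def compH_def inv twist_apply lext_smulv bprod_def)
    also have "\<dots> = mon n 1 + smulv (inverse (a (n - r)) * b (n - r)) (mon (n + 1) 0 - mon n 0)"
      unfolding 1 by (rule pairing_eqI) (simp add: a field_simps)
    finally show ?thesis .
  qed
  ultimately have "\<psi> \<in> Aut_star q" unfolding Aut_star_iff by blast
  then have "PhiG q (coordinates \<psi>) = \<psi>" by (rule PhiG_coordinates)
  moreover have "compH \<psi> (twist \<kappa>) = \<phi>"
    by (simp add: \<psi>_def compH_assoc twist_inverse[OF \<kappa>])
  ultimately show thesis using that[OF \<kappa>, of "coordinates \<psi>"] by simp
qed

lemma semidirect_bij:
  "bij_betw (\<lambda>(g, \<kappa>). compH (PhiG q g) (twist \<kappa>)) (UNIV \<times> carrier UnitsZ) (Aut_c q)"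
proof (rule bij_betw_imageI)
  show "inj_on (\<lambda>(g, \<kappa>). compH (PhiG q g) (twist \<kappa>)) (UNIV \<times> carrier UnitsZ)"
    by (auto simp: inj_on_def dest: semidirect_inject)
  have "compH (PhiG q g) (twist \<kappa>) \<in> Aut_c q" if "\<kappa> \<in> carrier UnitsZ" for g \<kappa>
    using PhiG_in_Aut_star[of g] that by (simp add: Aut_c_compH twist_Aut_c Aut_star_iff)
  moreover have "\<phi> \<in> (\<lambda>(g, \<kappa>). compH (PhiG q g) (twist \<kappa>)) ` (UNIV \<times> carrier UnitsZ)"
    if "\<phi> \<in> Aut_c q" for \<phi>
    using semidirect_surj[OF that] by (metis (no_types, lifting) SigmaI UNIV_I case_prod_conv image_eqI)
  ultimately show "(\<lambda>(g, \<kappa>). compH (PhiG q g) (twist \<kappa>)) ` (UNIV \<times> carrier UnitsZ) = Aut_c q"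
    by auto
qed

lemma twist_0: "twist (\<alpha>, 0) = phi_alpha \<alpha>"
  by (auto simp: fun_eq_iff twist_apply phi_alpha_def bprod_def)

text \<open>The composite sends 1 to x^r, so \<open>Aut_0\<close> corresponds to r = 0 and the
  second isomorphism is a restriction of the first.\<close>

lemma semidirect_Aut_0:
  assumes "\<kappa> \<in> carrier UnitsZ"
  shows "compH (PhiG q g) (twist \<kappa>) \<in> Aut_0 q \<longleftrightarrow> snd \<kappa> = 0"
proof -
  obtain \<alpha> r where \<kappa>: "\<kappa> = (\<alpha>, r)" by (cases \<kappa>)
  have "compH (PhiG q g) (twist \<kappa>) \<in> Aut_c q"
    using bij_betw_apply[OF semidirect_bij, of "(g, \<kappa>)"] assms by simp
  moreover have "compH (PhiG q g) (twist \<kappa>) (0, 0) = mon r 0"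
    by (simp add: \<kappa> compH_def twist_apply lext_smulv PhiG_0)
  moreover have "mon r 0 = (mon 0 0 :: 'k vecH) \<longleftrightarrow> r = 0"
    by (metis keys_mon prod.inject singleton_inject)
  ultimately show ?thesis by (simp add: Aut_0_def \<kappa>)
qed

lemma semidirect_bij_0:
  "bij_betw (\<lambda>(g, \<alpha>). compH (PhiG q g) (phi_alpha \<alpha>)) (UNIV \<times> carrier UnitsSeq) (Aut_0 q)"
proof (rule bij_betw_imageI)
  have seq: "\<alpha> \<in> carrier UnitsSeq \<longleftrightarrow> (\<alpha>, 0) \<in> carrier UnitsZ" for \<alpha> :: "int \<Rightarrow> 'k"
    by (simp add: UnitsSeq_def UnitsZ_def)
  show "inj_on (\<lambda>(g, \<alpha>). compH (PhiG q g) (phi_alpha \<alpha>)) (UNIV \<times> carrier UnitsSeq)"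
    by (auto simp: inj_on_def seq dest: semidirect_inject simp flip: twist_0)
  have "\<phi> \<in> (\<lambda>(g, \<alpha>). compH (PhiG q g) (phi_alpha \<alpha>)) ` (UNIV \<times> carrier UnitsSeq)"
    if "\<phi> \<in> Aut_0 q" for \<phi>
  proof -
    have "\<phi> \<in> Aut_c q" using that by (simp add: Aut_0_def)
    then obtain g \<kappa> where \<kappa>: "\<kappa> \<in> carrier UnitsZ" "\<phi> = compH (PhiG q g) (twist \<kappa>)"
      by (rule semidirect_surj)
    with that have "\<kappa> = (fst \<kappa>, 0)" by (simp add: semidirect_Aut_0 prod_eq_iff)
    with \<kappa> have "fst \<kappa> \<in> carrier UnitsSeq" "\<phi> = compH (PhiG q g) (phi_alpha (fst \<kappa>))"
      by (metis seq, metis twist_0)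
    then show ?thesis by force
  qed
  then show "(\<lambda>(g, \<alpha>). compH (PhiG q g) (phi_alpha \<alpha>)) ` (UNIV \<times> carrier UnitsSeq) = Aut_0 q"
    by (auto simp: seq semidirect_Aut_0 simp flip: twist_0)
qed

lemma semidirect_iso:
  "(\<lambda>(g, \<kappa>). compH (PhiG q g) (twist \<kappa>)) \<in> iso (sdprod (GinfG q) UnitsZ actG) (AutcG q)"
  using semidirect_bij bij_betw_apply[OF semidirect_bij]
  by (auto simp: iso_def hom_def sdprod_def AutcG_def semidirect_hom)

lemma semidirect_iso_0:
  "(\<lambda>(g, \<alpha>). compH (PhiG q g) (phi_alpha \<alpha>))
     \<in> iso (sdprod (GinfG q) UnitsSeq (\<lambda>\<alpha>. actG (\<alpha>, 0))) (Aut0G q)"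
proof -
  have "compH (PhiG q (g \<otimes>\<^bsub>GinfG q\<^esub> actG (\<alpha>, 0) g')) (phi_alpha (\<alpha> \<otimes>\<^bsub>UnitsSeq\<^esub> \<beta>)) =
    compH (compH (PhiG q g) (phi_alpha \<alpha>)) (compH (PhiG q g') (phi_alpha \<beta>))"
    if "\<alpha> \<in> carrier UnitsSeq" for g g' \<alpha> \<beta>
    using semidirect_hom[of "(\<alpha>, 0)" g g' "(\<beta>, 0)"] that
    by (simp add: UnitsZ_def UnitsSeq_def twist_0)
  then show ?thesis
    using semidirect_bij_0 bij_betw_apply[OF semidirect_bij_0]
    by (auto simp: iso_def hom_def sdprod_def Aut0G_def)
qed

end

theorem theorem3p17:
  fixes q :: "'k::field"
  assumes q_nz: "q \<noteq> 0"
    and q_not_root: "\<forall>n::nat. n > 0 \<longrightarrow> q ^ n \<noteq> 1"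
  shows "bij_betw (PhiG q) UNIV (Aut_star q)
    \<and> group (GinfG q)
    \<and> (\<forall>\<kappa>\<in>carrier UnitsZ. actG \<kappa> \<in> iso (GinfG q) (GinfG q))
    \<and> actG (\<one>\<^bsub>UnitsZ\<^esub>) = (\<lambda>B :: 'k Ginf. B)
    \<and> (\<forall>\<kappa>\<in>carrier (UnitsZ :: ((int \<Rightarrow> 'k) \<times> int) monoid). \<forall>\<kappa>'\<in>carrier (UnitsZ :: ((int \<Rightarrow> 'k) \<times> int) monoid).
           actG (\<kappa> \<otimes>\<^bsub>UnitsZ\<^esub> \<kappa>') = actG \<kappa> \<circ> actG \<kappa>')
    \<and> (\<lambda>(g, (\<alpha>, r)). compH (compH (PhiG q g) (phi_alpha \<alpha>)) (thetaH r))
           \<in> iso (sdprod (GinfG q) UnitsZ actG) (AutcG q)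
    \<and> (\<lambda>(g, \<alpha>). compH (PhiG q g) (phi_alpha \<alpha>))
           \<in> iso (sdprod (GinfG q) UnitsSeq (\<lambda>\<alpha>. actG (\<alpha>, 0))) (Aut0G q)"
proof -
  interpret generic_q q using q_not_root by unfold_locales
  have "(\<lambda>(g, (\<alpha>, r)). compH (compH (PhiG q g) (phi_alpha \<alpha>)) (thetaH r)) =
      (\<lambda>(g, \<kappa>). compH (PhiG q g) (twist \<kappa>))"
    by (auto simp: fun_eq_iff twist_def compH_assoc)
  then show ?thesis
    using bij_PhiG group_GinfG actG_iso semidirect_iso semidirect_iso_0
    by (auto simp: actG_one actG_mult comp_def)
qed

end
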